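(* Let $p\ge 2$ be a fixed integer. Then, as $x\to\infty$, $$\sum_{i,j\le x}((i,j)^{\ast\ast})^p=C^{\ast\ast}_p\,x^{p+1}+O(E^{\ast\ast}_p(x)),$$ where $$C^{\ast\ast}_p:=\frac{\zeta(p+1)}{p+1}\,D^{\ast}_p\sum_{n=1}^{\infty}\frac{2\overline{G}_p(n)-g_p(n^2)}{n^{p+1}},$$ $$D^{\ast}_p:=\prod_{q}\left(1-\frac2{q^{p+1}}+\frac1{q^{p+2}}\right)$$ (the product being over all primes $q$), $$g_p(n)=\prod_{q\mid n}\left(1-\frac1{q}\right)\left(1-\frac1{q^{p+1}}\right)\left(1-\frac2{q^{p+1}}+\frac1{q^{p+2}}\right)^{-1}$$ (the product being over the prime divisors $q$ of $n$), $$\overline{G}_p(n)=\sum_{k=1}^n g_p(kn),$$ and $E^{\ast\ast}_p(x)=x^p\log x$ for $p>2$ and $E^{\ast\ast}_2(x)=x^2(\log x)^3$.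
   Context: A positive divisor $d$ of a positive integer $n$ is a unitary divisor of $n$, written $d\parallel n$, if $\gcd(d,n/d)=1$. For positive integers $i,j$, $(i,j)^{\ast\ast}$ is the greatest common unitary divisor of $i$ and $j$ (the largest $d$ with $d\parallel i$ and $d\parallel j$). The sum is over all ordered pairs of positive integers $i,j\le x$, and $\zeta$ is the Riemann zeta function. The implied constant may depend on $p$. *)

theory Defs
  imports
    "HOL-Analysis.Infinite_Products"
    "HOL-Library.Landau_Symbols"
    "HOL-Computational_Algebra.Primes"
begin

definition unitary_dvd :: "nat \<Rightarrow> nat \<Rightarrow> bool" where
  "unitary_dvd d n \<longleftrightarrow> 0 < n \<and> d dvd n \<and> coprime d (n div d)"

text \<open>For positive arguments the set contains 1 and is finite.\<close>
definition gcud :: "nat \<Rightarrow> nat \<Rightarrow> nat" where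
  "gcud i j = Max {d. unitary_dvd d i \<and> unitary_dvd d j}"

text \<open>The Riemann zeta function, given by its Dirichlet series; only meaningful for
  \<open>s > 1\<close>, which covers all uses here (\<open>s = p + 1\<close>).\<close>
definition zeta :: "real \<Rightarrow> real" where
  "zeta s = (\<Sum>n. 1 / real (Suc n) powr s)"

definition local_factor :: "nat \<Rightarrow> nat \<Rightarrow> real" where
  "local_factor p q = 1 - 2 / real q ^ (p + 1) + 1 / real q ^ (p + 2)"

text \<open>The Euler product runs over the primes; other indices contribute the factor 1.\<close>
definition D_star :: "nat \<Rightarrow> real" where
  "D_star p = (\<Prod>q. if prime q then local_factor p q else 1)"

definition g :: "nat \<Rightarrow> nat \<Rightarrow> real" where
  "g p n = (\<Prod>q | prime q \<and> q dvd n.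
     (1 - 1 / real q) * (1 - 1 / real q ^ (p + 1)) * inverse (local_factor p q))"

definition G_bar :: "nat \<Rightarrow> nat \<Rightarrow> real" where
  "G_bar p n = (\<Sum>k = 1..n. g p (k * n))"

text \<open>The series over \<open>n \<ge> 1\<close> is indexed from 0, with \<open>n\<close> shifted to \<open>Suc n\<close>.\<close>
definition C_star_star :: "nat \<Rightarrow> real" where
  "C_star_star p = zeta (real p + 1) / (real p + 1) * D_star p *
     (\<Sum>n. (2 * G_bar p (Suc n) - g p ((Suc n)\<^sup>2)) / real (Suc n) ^ (p + 1))"

definition E_star_star :: "nat \<Rightarrow> real \<Rightarrow> real" where
  "E_star_star p x = (if p = 2 then x ^ 2 * ln x ^ 3 else x ^ p * ln x)"

end

theory Submission
  imports Defs "HOL-Analysis.Analysis"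
begin

text \<open>
Throughout, \<open>\<omega>(n)\<close> is the number of prime divisors of \<open>n\<close>,
\<open>c(n) = \<Prod>\<^bsub>q|n\<^esub> (1 - 1/q)\<close> is the density of the integers coprime to \<open>n\<close>,
\<open>u(n) = (-1)\<^bsup>\<omega>(n)\<^esup>\<close>, and \<open>M\<close> stands for \<open>max a b\<close>.

A pair with greatest common unitary divisor \<open>e\<close> is \<open>(e a, e b)\<close> for a unique pair \<open>(a,b)\<close> with
greatest common unitary divisor 1 and \<open>e\<close> coprime to \<open>a b\<close>. Hence the sum is
\<open>\<Sum>\<^bsub>(a,b)\<^esub> T(a b, x/M)\<close> over these primitive pairs, where \<open>T(m,y)\<close> sums \<open>e\<^sup>p\<close> over
\<open>e \<le> y\<close> coprime to \<open>m\<close> (\<open>sum_gcud_power_eq\<close>). Sieving by one prime of \<open>m\<close> at a time gives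
\<open>T(m,y) = c(m) y\<^bsup>p+1\<^esup>/(p+1) + O(2\<^bsup>\<omega>(m)\<^esup> y\<^sup>p)\<close> (\<open>coprime_power_sum_estimate\<close>).

The accumulated error is at most \<open>x\<^sup>p\<close> times the sum of \<open>2\<^bsup>\<omega>(a)+\<omega>(b)\<^esup> / M\<^sup>p\<close> over \<open>a, b \<le> x\<close>.
Since \<open>2\<^bsup>\<omega>\<^esup>\<close> is bounded by the divisor function, summing over the smaller entry costs a factor
\<open>M log x\<close>, and there remains the sum of \<open>2\<^bsup>\<omega>(n)\<^esup> / n\<^bsup>p-1\<^esup>\<close>, which is bounded for \<open>p > 2\<close> and
\<open>O((log x)\<^sup>2)\<close> for \<open>p = 2\<close> (\<open>sum_two_power_omega_pairs_le\<close>). This is where the two shapes of the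
error term come from.

The main terms add up to \<open>x\<^bsup>p+1\<^esup>/(p+1)\<close> times a partial sum of
\<open>K = \<Sum>\<^bsub>(a,b)\<^esub> c(a b) / M\<^bsup>p+1\<^esup>\<close> over primitive pairs, and the missing tail contributes only
\<open>O(x\<^sup>2)\<close>. What remains is that \<open>K/(p+1)\<close> is the constant of the theorem (\<open>C_star_star_eq\<close>).
Comparing Euler products,
\<open>\<zeta>(p+1) D g(m) = c(m) \<Sum> u(d) c(d) / d\<^bsup>p+1\<^esup>\<close> over all \<open>d\<close> coprime to \<open>m\<close>
(\<open>zeta_D_star_g_eq\<close>). Put \<open>m = a b\<close>, divide by \<open>M\<^bsup>p+1\<^esup>\<close> and sum over \<^emph>\<open>all\<close> pairs. On the left,
grouping by \<open>M\<close> produces the series of the constant. On the right, \<open>(A,B) = (d a, d b)\<close> turns the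
sum into one of \<open>c(A B) / max(A,B)\<^bsup>p+1\<^esup>\<close> weighted by the sum of \<open>u(d)\<close> over the common unitary
divisors \<open>d\<close> of \<open>A\<close> and \<open>B\<close>. That weight is 1 for primitive pairs and 0 otherwise, because \<open>u\<close> is
the unitary Moebius function; so the right side is \<open>K\<close>.
\<close>

section \<open>Common unitary divisors\<close>

text \<open>The part of \<open>n\<close> made of the full powers of the primes in \<open>P\<close>. As \<open>P\<close> runs over the sets of prime
divisors of \<open>n\<close>, this gives each unitary divisor exactly once.\<close>

definition unitary_part :: "nat \<Rightarrow> nat set \<Rightarrow> nat" where
  "unitary_part n P = (\<Prod>q\<in>P. q ^ multiplicity q n)"

definition shared_primes :: "nat \<Rightarrow> nat \<Rightarrow> nat set" where
  "shared_primes i j = {q \<in> prime_factors i. multiplicity q i = multiplicity q j}"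

text \<open>The unitary analogue of the Moebius function; it does not vanish on non-squarefree numbers.\<close>

definition usign :: "nat \<Rightarrow> real" where
  "usign d = (-1) ^ card (prime_factors d)"

lemma finite_shared_primes [simp]: "finite (shared_primes i j)"
  by (simp add: shared_primes_def)

lemma unitary_dvd_pos: "unitary_dvd d n \<Longrightarrow> 0 < d"
  by (auto simp: unitary_dvd_def intro!: Nat.gr0I)

lemma multiplicity_mult_coprime:
  fixes a b q :: nat
  assumes "a > 0" "b > 0" "coprime a b" "q \<in> prime_factors a"
  shows "multiplicity q (a * b) = multiplicity q a"
proof -
  have q: "prime q" "q dvd a" using assms by auto
  have "\<not> q dvd b" using q assms(3) coprime_common_divisor not_prime_unit by blast
  then show ?thesis using q assms by (simp add: prime_elem_multiplicity_mult_distrib not_dvd_imp_multiplicity_0)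
qed

lemma unitary_dvd_multiplicity:
  assumes "unitary_dvd d n" "q \<in> prime_factors d"
  shows "multiplicity q n = multiplicity q d"
proof -
  obtain k where k: "n = d * k" using assms(1) by (auto simp: unitary_dvd_def)
  have "d > 0" "k > 0" "coprime d k" using assms(1) unitary_dvd_pos[OF assms(1)] k
    by (auto simp: unitary_dvd_def)
  then show ?thesis using multiplicity_mult_coprime assms(2) k by simp
qed

lemma unitary_dvd_eq_unitary_part:
  assumes "unitary_dvd d n"
  shows "d = unitary_part n (prime_factors d)"
proof -
  have "d = (\<Prod>q\<in>prime_factors d. q ^ multiplicity q d)"
    using unitary_dvd_pos[OF assms] by (rule prime_factorization_nat)
  also have "\<dots> = unitary_part n (prime_factors d)"
    unfolding unitary_part_def using assms by (intro prod.cong) (auto simp: unitary_dvd_multiplicity)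
  finally show ?thesis .
qed

lemma prime_factors_unitary_part:
  assumes "n > 0" "P \<subseteq> prime_factors n"
  shows "prime_factors (unitary_part n P) = P"
proof -
  have fin: "finite P" using assms(2) finite_subset by blast
  have pr: "\<And>q. q \<in> P \<Longrightarrow> prime q" using assms(2) by auto
  have nz: "unitary_part n P \<noteq> 0"
    unfolding unitary_part_def using fin pr by (auto simp: prod_zero_iff)
  have "q \<in> prime_factors (unitary_part n P) \<longleftrightarrow> q \<in> P" for q
  proof (cases "prime q")
    case True
    have "multiplicity q (unitary_part n P) = (if q \<in> P then multiplicity q n else 0)"
      unfolding unitary_part_def using fin pr True by (intro multiplicity_prod_prime_powers)
    moreover have "q \<in> P \<Longrightarrow> multiplicity q n > 0" using assms
      by (auto simp: prime_factors_multiplicity)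
    ultimately show ?thesis using True by (auto simp: prime_factors_multiplicity)
  qed (use pr in auto)
  then show ?thesis by blast
qed

lemma unitary_dvd_unitary_part:
  assumes "n > 0" "P \<subseteq> prime_factors n"
  shows "unitary_dvd (unitary_part n P) n"
proof -
  let ?Q = "prime_factors n - P"
  have fin: "finite P" using assms(2) finite_subset by blast
  have n: "n = unitary_part n P * unitary_part n ?Q"
    using prime_factorization_nat[OF assms(1)] prod.subset_diff[OF assms(2), of "\<lambda>q. q ^ multiplicity q n"]
    unfolding unitary_part_def by (simp add: mult.commute)
  have "coprime (unitary_part n P) (unitary_part n ?Q)"
    unfolding unitary_part_def
  proof (intro prod_coprime_left prod_coprime_right)
    fix q r assume "q \<in> P" "r \<in> ?Q"
    then have "prime q" "prime r" "q \<noteq> r" using assms(2) by auto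
    then show "coprime (q ^ multiplicity q n) (r ^ multiplicity r n)"
      by (simp add: primes_coprime)
  qed
  moreover have "unitary_part n P > 0" using n assms(1) by (metis mult_0 neq0_conv)
  ultimately show ?thesis unfolding unitary_dvd_def using n assms(1)
    by (metis dvd_triv_left nonzero_mult_div_cancel_left not_gr_zero)
qed

lemma unitary_part_shared:
  assumes "P \<subseteq> shared_primes i j"
  shows "unitary_part i P = unitary_part j P"
  unfolding unitary_part_def using assms by (intro prod.cong) (auto simp: shared_primes_def)

lemma shared_primes_subset:
  assumes "i > 0" "j > 0"
  shows "shared_primes i j \<subseteq> prime_factors i" "shared_primes i j \<subseteq> prime_factors j"
  using assms by (auto simp: shared_primes_def prime_factors_multiplicity)

text \<open>A common unitary divisor is a choice of some of the prime powers that divide both numbers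
  exactly. Everything needed about \<^const>\<open>gcud\<close> is read off this parametrisation.\<close>

lemma bij_betw_common_unitary:
  assumes "i > 0" "j > 0"
  shows "bij_betw (unitary_part i) (Pow (shared_primes i j))
           {d. unitary_dvd d i \<and> unitary_dvd d j}"
proof (rule bij_betw_byWitness[where f' = prime_factors])
  note sub = shared_primes_subset[OF assms]
  show "\<forall>P\<in>Pow (shared_primes i j). prime_factors (unitary_part i P) = P"
    using prime_factors_unitary_part[OF assms(1)] sub by blast
  show "\<forall>d\<in>{d. unitary_dvd d i \<and> unitary_dvd d j}. unitary_part i (prime_factors d) = d"
    using unitary_dvd_eq_unitary_part by auto
  show "unitary_part i ` Pow (shared_primes i j) \<subseteq> {d. unitary_dvd d i \<and> unitary_dvd d j}"
  proof safe
    fix P assume P: "P \<subseteq> shared_primes i j"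
    show "unitary_dvd (unitary_part i P) i"
      using unitary_dvd_unitary_part assms P sub by blast
    show "unitary_dvd (unitary_part i P) j"
      unfolding unitary_part_shared[OF P] using unitary_dvd_unitary_part assms P sub by blast
  qed
  show "prime_factors ` {d. unitary_dvd d i \<and> unitary_dvd d j} \<subseteq> Pow (shared_primes i j)"
  proof safe
    fix d q assume d: "unitary_dvd d i" "unitary_dvd d j" and q: "q \<in> prime_factors d"
    have "d dvd i" using d by (simp add: unitary_dvd_def)
    then have "q \<in> prime_factors i" using q assms by (auto simp: in_prime_factors_iff)
    then show "q \<in> shared_primes i j"
      using unitary_dvd_multiplicity[OF d(1) q] unitary_dvd_multiplicity[OF d(2) q]
      by (simp add: shared_primes_def)
  qed
qed

lemma finite_common_unitary:
  assumes "i > 0" "j > 0"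
  shows "finite {d. unitary_dvd d i \<and> unitary_dvd d j}"
  using bij_betw_finite[OF bij_betw_common_unitary[OF assms]] by simp

text \<open>Taking all shared prime powers gives a multiple of every other choice, hence the maximum.\<close>

lemma gcud_eq_unitary_part:
  assumes "i > 0" "j > 0"
  shows "gcud i j = unitary_part i (shared_primes i j)"
  unfolding gcud_def
proof (rule Max_eqI)
  let ?R = "shared_primes i j"
  note sub = shared_primes_subset[OF assms]
  show "finite {d. unitary_dvd d i \<and> unitary_dvd d j}" by (rule finite_common_unitary[OF assms])
  show R: "unitary_part i ?R \<in> {d. unitary_dvd d i \<and> unitary_dvd d j}"
    using bij_betw_apply[OF bij_betw_common_unitary[OF assms]] by blast
  fix d assume "d \<in> {d. unitary_dvd d i \<and> unitary_dvd d j}"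
  then obtain P where P: "P \<subseteq> ?R" "d = unitary_part i P"
    using bij_betw_imp_surj_on[OF bij_betw_common_unitary[OF assms]] by blast
  have "d dvd unitary_part i ?R"
    unfolding P(2) unitary_part_def using P(1) by (intro prod_dvd_prod_subset) auto
  moreover have "unitary_part i ?R > 0" using R unitary_dvd_pos by blast
  ultimately show "d \<le> unitary_part i ?R" by (simp add: dvd_imp_le)
qed

lemma gcud_unitary_dvd:
  assumes "i > 0" "j > 0"
  shows "unitary_dvd (gcud i j) i" "unitary_dvd (gcud i j) j"
  using bij_betw_apply[OF bij_betw_common_unitary[OF assms], of "shared_primes i j"]
  by (auto simp: gcud_eq_unitary_part[OF assms])

lemma gcud_eq_1_iff:
  assumes "i > 0" "j > 0"
  shows "gcud i j = 1 \<longleftrightarrow> shared_primes i j = {}"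
proof
  assume "gcud i j = 1"
  then have "prime_factors (unitary_part i (shared_primes i j)) = {}"
    using gcud_eq_unitary_part[OF assms] by simp
  then show "shared_primes i j = {}"
    using prime_factors_unitary_part[OF assms(1) shared_primes_subset(1)[OF assms]] by simp
qed (simp add: gcud_eq_unitary_part[OF assms] unitary_part_def)

text \<open>Over the subsets of the set \<open>R\<close> of shared primes, \<open>(-1)\<^bsup>|P|\<^esup>\<close> sums to \<open>(1 - 1)\<^bsup>|R|\<^esup>\<close>.\<close>

lemma sum_usign_common_unitary:
  assumes "i > 0" "j > 0"
  shows "(\<Sum>d | unitary_dvd d i \<and> unitary_dvd d j. usign d) = (if gcud i j = 1 then 1 else 0)"
proof -
  let ?R = "shared_primes i j"
  have "(\<Sum>d | unitary_dvd d i \<and> unitary_dvd d j. usign d)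
      = (\<Sum>P\<in>Pow ?R. usign (unitary_part i P))"
    by (rule sum.reindex_bij_betw[OF bij_betw_common_unitary[OF assms], symmetric])
  also have "\<dots> = (\<Sum>P\<in>Pow ?R. (\<Prod>q\<in>P. - 1) * (\<Prod>q\<in>?R - P. 1))"
  proof (rule sum.cong)
    fix P assume "P \<in> Pow ?R"
    then have "prime_factors (unitary_part i P) = P"
      using prime_factors_unitary_part[OF assms(1)] shared_primes_subset[OF assms] by blast
    then show "usign (unitary_part i P) = (\<Prod>q\<in>P. - 1) * (\<Prod>q\<in>?R - P. 1)"
      by (simp add: usign_def)
  qed simp
  also have "\<dots> = (\<Prod>q\<in>?R. - 1 + 1)" by (rule prod_add[symmetric]) simp
  also have "\<dots> = (if gcud i j = 1 then 1 else 0)"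
    unfolding gcud_eq_1_iff[OF assms] by (simp add: power_0_left)
  finally show ?thesis .
qed

text \<open>Every prime of \<open>e\<close> occurs in \<open>e a\<close> and \<open>e b\<close> with its multiplicity in \<open>e\<close>, so it is shared;
at the other primes nothing changes.\<close>

lemma shared_primes_mult_coprime:
  assumes "a > 0" "b > 0" "e > 0" "coprime e a" "coprime e b"
  shows "shared_primes (e * a) (e * b) = prime_factors e \<union> shared_primes a b"
    and "prime_factors e \<inter> shared_primes a b = {}"
proof -
  have dis: "q \<notin> prime_factors a" "q \<notin> prime_factors b" if "q \<in> prime_factors e" for q
    using that assms coprime_common_divisor not_prime_unit by blast+
  have m: "multiplicity q (e * k) = multiplicity q e + multiplicity q k"
    if "prime q" "k > 0" for q k
    using that assms by (simp add: prime_elem_multiplicity_mult_distrib)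
  have z: "multiplicity q a = 0" "multiplicity q b = 0" if "q \<in> prime_factors e" for q
    using dis[OF that] that assms by (auto simp: prime_factors_multiplicity)
  show "prime_factors e \<inter> shared_primes a b = {}" using dis by (auto simp: shared_primes_def)
  show "shared_primes (e * a) (e * b) = prime_factors e \<union> shared_primes a b"
    unfolding shared_primes_def using assms z m
    by (auto simp: prime_factors_product in_prime_factors_imp_prime)
qed

lemma gcud_mult_coprime:
  assumes "a > 0" "b > 0" "e > 0" "coprime e a" "coprime e b"
  shows "gcud (e * a) (e * b) = e * gcud a b"
proof -
  let ?R = "shared_primes a b"
  note sh = shared_primes_mult_coprime[OF assms]
  have pf: "?R \<subseteq> prime_factors a" using shared_primes_subset assms by blast
  have "gcud (e * a) (e * b) = unitary_part (e * a) (prime_factors e \<union> ?R)"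
    using assms by (simp add: gcud_eq_unitary_part sh)
  also have "\<dots> = unitary_part (e * a) (prime_factors e) * unitary_part (e * a) ?R"
    unfolding unitary_part_def using sh(2) by (intro prod.union_disjoint) auto
  also have "unitary_part (e * a) (prime_factors e) = (\<Prod>q\<in>prime_factors e. q ^ multiplicity q e)"
    unfolding unitary_part_def using assms multiplicity_mult_coprime by (intro prod.cong) auto
  also have "\<dots> = e" using prime_factorization_nat assms by metis
  also have "unitary_part (e * a) ?R = unitary_part a ?R"
    unfolding unitary_part_def
  proof (intro prod.cong refl)
    fix q assume "q \<in> ?R"
    then have "q \<in> prime_factors a" using pf by blast
    then have "multiplicity q (a * e) = multiplicity q a"
      using assms by (intro multiplicity_mult_coprime) (auto simp: coprime_commute)
    then show "q ^ multiplicity q (e * a) = q ^ multiplicity q a" by (simp add: mult.commute)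
  qed
  also have "unitary_part a ?R = gcud a b" using gcud_eq_unitary_part assms by simp
  finally show ?thesis .
qed

lemma gcud_pos:
  assumes "i > 0" "j > 0"
  shows "gcud i j > 0"
  using gcud_unitary_dvd[OF assms] unitary_dvd_pos by blast

lemma gcud_div_gcud:
  assumes "i > 0" "j > 0"
  shows "gcud (i div gcud i j) (j div gcud i j) = 1"
proof -
  let ?e = "gcud i j"
  note u = gcud_unitary_dvd[OF assms, unfolded unitary_dvd_def]
  have *: "?e * (i div ?e) = i" "?e * (j div ?e) = j" using u by auto
  have pos: "i div ?e > 0" "j div ?e > 0" using * assms by (metis gr0I mult_0_right less_irrefl)+
  have "?e = ?e * gcud (i div ?e) (j div ?e)"
    using gcud_mult_coprime[of "i div ?e" "j div ?e" ?e] u * pos gcud_pos[OF assms] by simp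
  then show ?thesis using gcud_pos[OF assms] by simp
qed

section \<open>Power sums over integers coprime to a modulus\<close>

definition coprime_power_sum :: "nat \<Rightarrow> nat set \<Rightarrow> real \<Rightarrow> real" where
  "coprime_power_sum p P y = (\<Sum>e | 0 < e \<and> real e \<le> y \<and> (\<forall>q\<in>P. \<not> q dvd e). real e ^ p)"

lemma coprime_iff_prime_factors:
  fixes e m :: nat
  assumes "m > 0"
  shows "coprime e m \<longleftrightarrow> (\<forall>q\<in>prime_factors m. \<not> q dvd e)"
proof (cases "coprime e m")
  case False
  then have "gcd e m \<noteq> 1" by (simp add: coprime_iff_gcd_eq_1)
  then obtain q where "prime q" "q dvd gcd e m" using prime_factor_nat by blast
  then show ?thesis using assms False by (auto simp: in_prime_factors_iff)
next
  case True
  then show ?thesis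
    by (meson coprime_common_divisor in_prime_factors_iff not_prime_unit)
qed

text \<open>Sorting the pairs by \<open>e = (i,j)\<^sup>*\<^sup>*\<close>: they are exactly the pairs \<open>(e a, e b)\<close> with
  \<open>e\<close> coprime to \<open>a b\<close> and \<open>(a,b)\<^sup>*\<^sup>* = 1\<close>.\<close>

lemma sum_gcud_power_eq:
  fixes x :: real and p :: nat
  defines "I \<equiv> {i. 0 < i \<and> real i \<le> x}"
  shows "(\<Sum>i\<in>I. \<Sum>j\<in>I. real (gcud i j) ^ p) =
    (\<Sum>(a,b) | a \<in> I \<and> b \<in> I \<and> gcud a b = 1.
       coprime_power_sum p (prime_factors (a * b)) (x / real (max a b)))"
proof -
  have fin: "finite I"
  proof (rule finite_subset)
    show "I \<subseteq> {..nat \<lfloor>x\<rfloor>}" unfolding I_def by (auto simp: le_nat_floor)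
  qed simp
  let ?A = "{(a,b). a \<in> I \<and> b \<in> I \<and> gcud a b = 1}"
  let ?B = "\<lambda>(a,b). {e. 0 < e \<and> real e \<le> x / real (max a b) \<and> (\<forall>q\<in>prime_factors (a * b). \<not> q dvd e)}"
  have finA: "finite ?A" by (rule finite_subset[of _ "I \<times> I"]) (use fin in auto)
  have finB: "finite (?B ab)" for ab
  proof -
    obtain a b where ab: "ab = (a,b)" by (cases ab)
    have "?B ab \<subseteq> {..nat \<lfloor>x / real (max a b)\<rfloor>}" unfolding ab by (auto simp: le_nat_floor)
    then show ?thesis using finite_subset by blast
  qed
  have B: "e \<in> ?B (a,b) \<longleftrightarrow> e > 0 \<and> real (e * a) \<le> x \<and> real (e * b) \<le> x \<and> coprime e a \<and> coprime e b"
    if "a > 0" "b > 0" for a b e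
  proof -
    have "real e \<le> x / real (max a b) \<longleftrightarrow> real (e * max a b) \<le> x"
      using that by (simp add: field_simps)
    also have "\<dots> \<longleftrightarrow> real (e * a) \<le> x \<and> real (e * b) \<le> x"
      using mult_left_mono[of "real a" "real b" "real e"] mult_left_mono[of "real b" "real a" "real e"]
      by (cases "a \<le> b") (auto simp: max_def)
    finally have "real e \<le> x / real (max a b) \<longleftrightarrow> real (e * a) \<le> x \<and> real (e * b) \<le> x" .
    moreover have "(\<forall>q\<in>prime_factors (a * b). \<not> q dvd e) \<longleftrightarrow> coprime e a \<and> coprime e b"
      using coprime_iff_prime_factors[of "a * b" e] that unfolding coprime_mult_right_iff by simp
    ultimately show ?thesis unfolding prod.case mem_Collect_eq by blast
  qed
  \<comment> \<open>the pair \<open>(i,j)\<close> corresponds to \<open>((a,b),e)\<close> with \<open>e\<close> its greatest common unitary divisor\<close>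
  define f where "f = (\<lambda>(i,j). ((i div gcud i j, j div gcud i j), gcud i j))"
  define f' :: "(nat \<times> nat) \<times> nat \<Rightarrow> nat \<times> nat" where "f' = (\<lambda>((a,b),e). (e * a, e * b))"
  have "(\<Sum>i\<in>I. \<Sum>j\<in>I. real (gcud i j) ^ p) = (\<Sum>(i,j)\<in>I \<times> I. real (gcud i j) ^ p)"
    by (simp add: sum.cartesian_product)
  also have "\<dots> = (\<Sum>t\<in>Sigma ?A ?B. real (snd t) ^ p)"
  proof (rule sum.reindex_bij_witness[of _ f' f])
    fix ij assume "ij \<in> I \<times> I"
    then obtain i j where ij: "ij = (i,j)" "i \<in> I" "j \<in> I" by blast
    then have pos: "i > 0" "j > 0" by (simp_all add: I_def)
    let ?e = "gcud i j"
    note u = gcud_unitary_dvd[OF pos, unfolded unitary_dvd_def]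
    have *: "?e * (i div ?e) = i" "?e * (j div ?e) = j" using u by simp_all
    have pos': "i div ?e > 0" "j div ?e > 0" using * pos by (metis gr0I mult_0_right less_irrefl)+
    have x: "real i \<le> x" "real j \<le> x" using ij by (simp_all add: I_def)
    have "real (i div ?e) \<le> x" "real (j div ?e) \<le> x"
      by (rule order_trans[OF of_nat_mono[OF div_le_dividend] x(1)],
          rule order_trans[OF of_nat_mono[OF div_le_dividend] x(2)])
    then have "i div ?e \<in> I" "j div ?e \<in> I"
      using pos' by (simp_all add: I_def)
    moreover have "?e \<in> ?B (i div ?e, j div ?e)"
      unfolding B[OF pos'] * using u gcud_pos[OF pos] x by blast
    ultimately show "f ij \<in> Sigma ?A ?B"
      using gcud_div_gcud[OF pos] unfolding ij f_def prod.case mem_Sigma_iff mem_Collect_eq by (elim conjE, intro conjI)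
    show "f' (f ij) = ij" using * by (simp add: ij f_def f'_def)
    show "real (snd (f ij)) ^ p = (case ij of (i,j) \<Rightarrow> real (gcud i j) ^ p)"
      by (simp add: ij f_def)
  next
    fix t assume t_in: "t \<in> Sigma ?A ?B"
    obtain a b e where t_eq: "t = ((a,b),e)" by (metis surj_pair)
    have t: "a \<in> I" "b \<in> I" "gcud a b = 1" "e \<in> ?B (a,b)"
      using t_in unfolding t_eq by blast+
    have pos: "a > 0" "b > 0" using t by (simp_all add: I_def)
    note e = t(4)[unfolded B[OF pos]]
    have "gcud (e * a) (e * b) = e" using gcud_mult_coprime[of a b e] e pos t(3) by simp
    then show "f (f' t) = t"
      using e by (simp add: t_eq f_def f'_def)
    show "f' t \<in> I \<times> I"
      using e pos by (simp add: t_eq I_def f'_def)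
  qed
  also have "\<dots> = (\<Sum>ab\<in>?A. \<Sum>e\<in>?B ab. real e ^ p)"
    using finA finB by (subst sum.Sigma) (auto simp: split_def)
  also have "\<dots> = (\<Sum>(a,b)\<in>?A. coprime_power_sum p (prime_factors (a * b)) (x / real (max a b)))"
    by (rule sum.cong) (auto simp: coprime_power_sum_def)
  finally show ?thesis .
qed

text \<open>The mean value bounds for \<open>t\<^bsup>p+1\<^esup>\<close>; they compare a sum of powers with an integral.\<close>

lemma power_Suc_diff_bounds:
  fixes a b :: real
  assumes "0 \<le> a" "a \<le> b"
  shows "real (p + 1) * a ^ p * (b - a) \<le> b ^ (p + 1) - a ^ (p + 1)"
    and "b ^ (p + 1) - a ^ (p + 1) \<le> real (p + 1) * b ^ p * (b - a)"
proof -
  have eq: "b ^ (p + 1) - a ^ (p + 1) = (b - a) * (\<Sum>i<Suc p. b ^ (p - i) * a ^ i)"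
    using power_diff_sumr2[of a "Suc p" b] by (simp add: algebra_simps)
  \<comment> \<open>each summand lies between \<open>a\<^sup>p\<close> and \<open>b\<^sup>p\<close>\<close>
  have "a ^ p = a ^ (p - i) * a ^ i" "b ^ p = b ^ (p - i) * b ^ i" if "i < Suc p" for i
    using that by (simp_all flip: power_add)
  then have "a ^ p \<le> b ^ (p - i) * a ^ i" "b ^ (p - i) * a ^ i \<le> b ^ p" if "i < Suc p" for i
    using that assms by (auto intro!: mult_right_mono mult_left_mono power_mono)
  then have "(\<Sum>i<Suc p. a ^ p) \<le> (\<Sum>i<Suc p. b ^ (p - i) * a ^ i)"
      "(\<Sum>i<Suc p. b ^ (p - i) * a ^ i) \<le> (\<Sum>i<Suc p. b ^ p)"
    by (intro sum_mono; simp only: lessThan_iff)+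
  moreover have "(\<Sum>i<Suc p. c ^ p) = real (p + 1) * c ^ p" for c :: real
    by (simp only: sum_constant card_lessThan Suc_eq_plus1)
  ultimately have "real (p + 1) * a ^ p \<le> (\<Sum>i<Suc p. b ^ (p - i) * a ^ i)"
      "(\<Sum>i<Suc p. b ^ (p - i) * a ^ i) \<le> real (p + 1) * b ^ p"
    by simp_all
  then have "(b - a) * (real (p + 1) * a ^ p) \<le> (b - a) * (\<Sum>i<Suc p. b ^ (p - i) * a ^ i)"
      "(b - a) * (\<Sum>i<Suc p. b ^ (p - i) * a ^ i) \<le> (b - a) * (real (p + 1) * b ^ p)"
    using assms by (auto intro!: mult_left_mono simp del: sum.lessThan_Suc)
  then show "real (p + 1) * a ^ p * (b - a) \<le> b ^ (p + 1) - a ^ (p + 1)"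
    "b ^ (p + 1) - a ^ (p + 1) \<le> real (p + 1) * b ^ p * (b - a)"
    unfolding eq by (simp_all only: mult_ac)
qed

lemma sum_powers_bounds:
  "real n ^ (p + 1) / real (p + 1) \<le> (\<Sum>e=1..n. real e ^ p)"
  "(\<Sum>e=1..n. real e ^ p) \<le> real n ^ p + real n ^ (p + 1) / real (p + 1)"
proof (induction n)
  case (Suc n)
  have "real (p + 1) * real n ^ p \<le> real (Suc n) ^ (p + 1) - real n ^ (p + 1)"
       "real (Suc n) ^ (p + 1) - real n ^ (p + 1) \<le> real (p + 1) * real (Suc n) ^ p"
    using power_Suc_diff_bounds[of "real n" "real (Suc n)" p] by simp_all
  then have *: "real n ^ p \<le> real (Suc n) ^ (p + 1) / real (p + 1) - real n ^ (p + 1) / real (p + 1)"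
       "real (Suc n) ^ (p + 1) / real (p + 1) - real n ^ (p + 1) / real (p + 1) \<le> real (Suc n) ^ p"
    by (simp_all only: diff_divide_distrib[symmetric] pos_le_divide_eq pos_divide_le_eq of_nat_0_less_iff
        zero_less_Suc Suc_eq_plus1[symmetric] mult.commute)
  have **: "(\<Sum>e=1..Suc n. real e ^ p) = (\<Sum>e=1..n. real e ^ p) + real (Suc n) ^ p" by simp
  { case 1 show ?case using Suc.IH(1) *(2) unfolding ** by linarith }
  { case 2 show ?case using Suc.IH(2) *(1) unfolding ** by linarith }
qed simp_all

lemma sum_powers_estimate:
  fixes y :: real
  assumes "0 \<le> y"
  shows "\<bar>coprime_power_sum p {} y - y ^ (p + 1) / real (p + 1)\<bar> \<le> y ^ p"
proof -
  define n where "n = nat \<lfloor>y\<rfloor>"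
  have n: "real n \<le> y" "y - real n \<le> 1" using assms unfolding n_def by linarith+
  have "{e. 0 < e \<and> real e \<le> y} = {1..n}" using assms by (auto simp: n_def le_nat_iff le_floor_iff)
  then have S: "coprime_power_sum p {} y = (\<Sum>e=1..n. real e ^ p)"
    by (simp add: coprime_power_sum_def)
  have "y ^ (p + 1) - real n ^ (p + 1) \<le> real (p + 1) * y ^ p * (y - real n)"
    using power_Suc_diff_bounds(2)[of "real n" y p] n by simp
  also have "\<dots> \<le> real (p + 1) * y ^ p"
    using n assms mult_left_mono[of "y - real n" 1 "real (p + 1) * y ^ p"] by simp
  finally have "y ^ (p + 1) / real (p + 1) - real n ^ (p + 1) / real (p + 1) \<le> y ^ p"
    by (simp only: diff_divide_distrib[symmetric] pos_divide_le_eq of_nat_0_less_iff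
        zero_less_Suc Suc_eq_plus1[symmetric] mult.commute)
  moreover have "real n ^ p \<le> y ^ p" "real n ^ (p + 1) / real (p + 1) \<le> y ^ (p + 1) / real (p + 1)"
    using n by (auto intro!: power_mono divide_right_mono simp del: power_Suc)
  ultimately show ?thesis using sum_powers_bounds(1)[where n = n and p = p] sum_powers_bounds(2)[where n = n and p = p] unfolding S by linarith
qed

text \<open>Of the numbers coprime to \<open>P\<close>, those divisible by a further prime \<open>q\<close> are the products \<open>q k\<close> with
\<open>k\<close> coprime to \<open>P\<close>.\<close>

lemma coprime_power_sum_insert:
  assumes "prime q" "\<And>r. r \<in> P \<Longrightarrow> prime r" "q \<notin> P"
  shows "coprime_power_sum p (insert q P) y =
           coprime_power_sum p P y - real q ^ p * coprime_power_sum p P (y / real q)"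
proof -
  let ?S = "\<lambda>P y. {e. 0 < e \<and> real e \<le> y \<and> (\<forall>r\<in>P. \<not> r dvd e)}"
  have q: "q > 0" using assms prime_gt_0_nat by blast
  have fin: "finite (?S P y)" for P y
    by (rule finite_subset[of _ "{..nat \<lfloor>y\<rfloor>}"]) (auto simp: le_nat_floor)
  have im: "{e \<in> ?S P y. q dvd e} = (*) q ` ?S P (y / real q)"
  proof (intro set_eqI iffI)
    fix e assume "e \<in> {e \<in> ?S P y. q dvd e}"
    then obtain k where k: "e = q * k" "e \<in> ?S P y" by auto
    then have "k \<in> ?S P (y / real q)" using q by (auto simp: field_simps)
    then show "e \<in> (*) q ` ?S P (y / real q)" using k by blast
  next
    fix e assume "e \<in> (*) q ` ?S P (y / real q)"
    then obtain k where k: "e = q * k" "k \<in> ?S P (y / real q)" by auto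
    have "\<not> r dvd q * k" if "r \<in> P" for r
    proof
      assume "r dvd q * k"
      then have "r dvd q" using that k assms by (auto simp: prime_dvd_mult_iff)
      then show False using that assms primes_dvd_imp_eq by blast
    qed
    then show "e \<in> {e \<in> ?S P y. q dvd e}" using k q by (auto simp: field_simps)
  qed
  have "coprime_power_sum p P y = (\<Sum>e\<in>?S (insert q P) y \<union> {e \<in> ?S P y. q dvd e}. real e ^ p)"
    unfolding coprime_power_sum_def by (rule sum.cong) auto
  also have "\<dots> = coprime_power_sum p (insert q P) y + (\<Sum>e\<in>{e \<in> ?S P y. q dvd e}. real e ^ p)"
    unfolding coprime_power_sum_def
  proof (rule sum.union_disjoint)
    show "finite (?S (insert q P) y)" by (rule fin)
    show "finite {e \<in> ?S P y. q dvd e}" by (rule finite_subset[OF _ fin[where P = P and y = y]]) auto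
  qed auto
  also have "(\<Sum>e\<in>{e \<in> ?S P y. q dvd e}. real e ^ p) = real q ^ p * coprime_power_sum p P (y / real q)"
    unfolding im coprime_power_sum_def using q
    by (subst sum.reindex) (auto simp: inj_on_def sum_distrib_left power_mult_distrib)
  finally show ?thesis by simp
qed

text \<open>Induction on \<open>P\<close>: in the recursion for a new prime \<open>q\<close>, the subtracted term is \<open>1/q\<close> times the main
term, and since \<open>q\<^sup>p (y/q)\<^sup>p = y\<^sup>p\<close> its error has the size of the error before. So each prime
multiplies the density by \<open>1 - 1/q\<close> and doubles the error.\<close>

lemma coprime_power_sum_estimate:
  fixes y :: real
  assumes "finite P" "\<And>q. q \<in> P \<Longrightarrow> prime q" "0 \<le> y"
  shows "\<bar>coprime_power_sum p P y - (\<Prod>q\<in>P. 1 - 1 / real q) * y ^ (p + 1) / real (p + 1)\<bar>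
           \<le> 2 ^ card P * y ^ p"
  using assms
proof (induction P arbitrary: y rule: finite_induct)
  case empty
  then show ?case using sum_powers_estimate[of y p] by simp
next
  case (insert q P)
  have q: "real q > 0" using insert.prems prime_gt_0_nat by auto
  let ?c = "\<Prod>q\<in>P. 1 - 1 / real q" and ?T = "coprime_power_sum p P"
  have 1: "\<bar>?T y - ?c * y ^ (p + 1) / real (p + 1)\<bar> \<le> 2 ^ card P * y ^ p"
    by (rule insert.IH) (use insert.prems in auto)
  have "\<bar>?T (y / q) - ?c * (y / q) ^ (p + 1) / real (p + 1)\<bar> \<le> 2 ^ card P * (y / q) ^ p"
    by (rule insert.IH) (use insert.prems in auto)
  then have "real q ^ p * \<bar>?T (y / q) - ?c * (y / q) ^ (p + 1) / real (p + 1)\<bar>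
      \<le> real q ^ p * (2 ^ card P * (y / q) ^ p)"
    using q by (intro mult_left_mono) auto
  then have "\<bar>real q ^ p * (?T (y / q) - ?c * (y / q) ^ (p + 1) / real (p + 1))\<bar>
      \<le> 2 ^ card P * y ^ p"
    using q by (simp add: abs_mult power_divide)
  moreover have "real q ^ p * (?T (y / q) - ?c * (y / q) ^ (p + 1) / real (p + 1))
      = real q ^ p * ?T (y / q) - (1 / q) * (?c * y ^ (p + 1) / real (p + 1))"
  proof -
    have "real q ^ p * (?c * (y / q) ^ (p + 1) / real (p + 1)) = (1 / q) * (?c * y ^ (p + 1) / real (p + 1))"
      using q by (simp add: power_divide)
    then show ?thesis by (simp only: right_diff_distrib)
  qed
  ultimately have 2: "\<bar>real q ^ p * ?T (y / q) - (1 / q) * (?c * y ^ (p + 1) / real (p + 1))\<bar>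
      \<le> 2 ^ card P * y ^ p"
    by simp
  have T: "coprime_power_sum p (insert q P) y = ?T y - real q ^ p * ?T (y / q)"
    by (rule coprime_power_sum_insert) (use insert in auto)
  have c: "(\<Prod>q\<in>insert q P. 1 - 1 / real q) * y ^ (p + 1) / real (p + 1)
      = ?c * y ^ (p + 1) / real (p + 1) - (1 / q) * (?c * y ^ (p + 1) / real (p + 1))"
    using insert by (simp add: algebra_simps diff_divide_distrib)
  have "card (insert q P) = Suc (card P)" using insert by simp
  then have e: "2 ^ card (insert q P) * y ^ p = 2 ^ card P * y ^ p + 2 ^ card P * y ^ p"
    by (simp only: power_Suc mult_2 distrib_right)
  show ?case unfolding T c e using 1 2 by linarith
qed

section \<open>The accumulated error\<close>

text \<open>Each pair is counted once with its larger entry first and once with it second; pairs on the diagonal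
are counted twice, whence only an inequality.\<close>

lemma sum_pairs_le_max:
  fixes h w :: "nat \<Rightarrow> real"
  assumes "\<And>n. h n \<ge> 0" "\<And>n. w n \<ge> 0"
  shows "(\<Sum>a=1..N. \<Sum>b=1..N. h a * h b * w (max a b))
           \<le> 2 * (\<Sum>n=1..N. w n * h n * (\<Sum>k=1..n. h k))"
proof -
  let ?t = "\<lambda>a b. h a * h b * w a"
  have *: "(\<Sum>a=1..N. \<Sum>b=1..N. if b \<le> a then ?t a b else 0)
      = (\<Sum>n=1..N. w n * h n * (\<Sum>k=1..n. h k))"
  proof (rule sum.cong)
    fix a assume "a \<in> {1..N}"
    then have "{b\<in>{1..N}. b \<le> a} = {1..a}" by auto
    then have "(\<Sum>b=1..N. if b \<le> a then ?t a b else 0) = (\<Sum>b=1..a. ?t a b)"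
      using sum.inter_filter[of "{1..N}" "?t a" "\<lambda>b. b \<le> a"] by simp
    also have "\<dots> = w a * h a * (\<Sum>k=1..a. h k)"
      unfolding sum_distrib_left by (rule sum.cong[OF refl]) (simp only: mult_ac)
    finally show "(\<Sum>b=1..N. if b \<le> a then ?t a b else 0) = w a * h a * (\<Sum>k=1..a. h k)" .
  qed simp
  have "(\<Sum>a=1..N. \<Sum>b=1..N. h a * h b * w (max a b))
      \<le> (\<Sum>a=1..N. \<Sum>b=1..N. (if b \<le> a then ?t a b else 0) + (if a \<le> b then ?t b a else 0))"
  proof (intro sum_mono)
    fix a b
    have "?t a b \<ge> 0" "?t b a \<ge> 0" using assms by simp_all
    moreover have "h a * h b = h b * h a" by (rule mult.commute)
    ultimately show "h a * h b * w (max a b)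
        \<le> (if b \<le> a then ?t a b else 0) + (if a \<le> b then ?t b a else 0)"
      by (cases a b rule: linorder_cases) (simp_all add: max_def)
  qed
  also have "\<dots> = (\<Sum>a=1..N. \<Sum>b=1..N. if b \<le> a then ?t a b else 0)
      + (\<Sum>a=1..N. \<Sum>b=1..N. if a \<le> b then ?t b a else 0)"
    by (simp add: sum.distrib)
  also have "(\<Sum>a=1..N. \<Sum>b=1..N. if a \<le> b then ?t b a else 0)
      = (\<Sum>b=1..N. \<Sum>a=1..N. if a \<le> b then ?t b a else 0)"
    by (rule sum.swap)
  finally show ?thesis unfolding * mult_2 .
qed

text \<open>The left side is the number of unitary divisors.\<close>

lemma two_power_omega_le_divisors:
  fixes n :: nat
  assumes "n > 0"
  shows "2 ^ card (prime_factors n) \<le> card {d. d dvd n}"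
proof -
  have "card (Pow (prime_factors n)) \<le> card {d. d dvd n}"
  proof (rule card_inj_on_le)
    show "inj_on (unitary_part n) (Pow (prime_factors n))"
      using prime_factors_unitary_part[OF assms] by (intro inj_on_inverseI[where g = prime_factors]) auto
    show "unitary_part n ` Pow (prime_factors n) \<subseteq> {d. d dvd n}"
      using unitary_dvd_unitary_part[OF assms] by (auto simp: unitary_dvd_def)
  qed (use assms in auto)
  then show ?thesis by (simp add: card_Pow)
qed

lemma sum_divisors_weighted:
  fixes w :: "nat \<Rightarrow> real"
  shows "(\<Sum>k=1..n. real (card {d. d dvd k}) * w k) = (\<Sum>d=1..n. \<Sum>l=1..n div d. w (d * l))"
proof -
  have "(\<Sum>k=1..n. real (card {d. d dvd k}) * w k) = (\<Sum>k=1..n. \<Sum>d | d \<in> {1..n} \<and> d dvd k. w k)"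
  proof (rule sum.cong)
    fix k assume k: "k \<in> {1..n}"
    then have "{d. d dvd k} = {d. d \<in> {1..n} \<and> d dvd k}"
      by (auto dest: dvd_imp_le intro!: Suc_leI Nat.gr0I)
    then show "real (card {d. d dvd k}) * w k = (\<Sum>d | d \<in> {1..n} \<and> d dvd k. w k)" by simp
  qed simp
  also have "\<dots> = (\<Sum>d=1..n. \<Sum>k | k \<in> {1..n} \<and> d dvd k. w k)"
    by (rule sum.swap_restrict) auto
  also have "\<dots> = (\<Sum>d=1..n. \<Sum>l=1..n div d. w (d * l))"
  proof (rule sum.cong)
    fix d assume d: "d \<in> {1..n}"
    show "(\<Sum>k | k \<in> {1..n} \<and> d dvd k. w k) = (\<Sum>l=1..n div d. w (d * l))"
      by (rule sum.reindex_bij_witness[of _ "\<lambda>l. d * l" "\<lambda>k. k div d"])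
         (use d in \<open>auto simp: less_eq_div_iff_mult_less_eq mult_ac div_le_mono Suc_le_eq div_greater_zero_iff dvd_imp_le\<close>)
  qed simp
  finally show ?thesis .
qed

lemma sum_divisor_count_le: "(\<Sum>k=1..n. real (card {d. d dvd k})) \<le> real n * harm n"
proof -
  have "(\<Sum>k=1..n. real (card {d. d dvd k})) = (\<Sum>d=1..n. real (n div d))"
    using sum_divisors_weighted[of "\<lambda>_. 1" n] by simp
  also have "\<dots> \<le> (\<Sum>d=1..n. real n * inverse (real d))"
    by (intro sum_mono) (auto simp: divide_inverse[symmetric] intro: of_nat_div_le_of_nat)
  also have "\<dots> = real n * harm n" by (simp add: harm_def sum_distrib_left)
  finally show ?thesis .
qed

text \<open>Writing \<open>k = d l\<close> factors the weight, and dropping the constraint \<open>d l \<le> n\<close> leaves a square.\<close>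

lemma sum_divisor_count_weighted_le:
  "(\<Sum>k=1..n. real (card {d. d dvd k}) / real k ^ r) \<le> (\<Sum>d=1..n. 1 / real d ^ r) ^ 2"
proof -
  have "(\<Sum>k=1..n. real (card {d. d dvd k}) / real k ^ r)
      = (\<Sum>d=1..n. \<Sum>l=1..n div d. 1 / real d ^ r * (1 / real l ^ r))"
    using sum_divisors_weighted[of "\<lambda>k. 1 / real k ^ r" n] by (simp add: power_mult_distrib)
  also have "\<dots> \<le> (\<Sum>d=1..n. \<Sum>l=1..n. 1 / real d ^ r * (1 / real l ^ r))"
    by (intro sum_mono sum_mono2) (auto intro: order_trans[OF _ div_le_dividend])
  also have "\<dots> = (\<Sum>d=1..n. 1 / real d ^ r) ^ 2"
    by (simp only: power2_eq_square sum_product)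
  finally show ?thesis .
qed

text \<open>Telescoping: \<open>1/n\<^sup>2 \<le> 1/(n-1) - 1/n\<close>.\<close>

lemma sum_inverse_squares_le:
  assumes "N \<ge> 1"
  shows "(\<Sum>n=Suc N..M. 1 / real n ^ 2) \<le> 1 / real N"
proof -
  have "(\<Sum>n=Suc N..M. 1 / real n ^ 2) \<le> 1 / real N - 1 / real (max N M)"
  proof (induction M)
    case (Suc M)
    show ?case
    proof (cases "Suc M \<ge> Suc N")
      case True
      then have M: "real M > 0" "max N M = M" "max N (Suc M) = Suc M" using assms by auto
      have "1 / real (Suc M) ^ 2 \<le> 1 / real M - 1 / real (Suc M)"
        using M(1) by (simp add: divide_simps power2_eq_square)
      then show ?thesis using Suc True M by simp
    qed (use assms in auto)
  qed (use assms in auto)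
  also have "\<dots> \<le> 1 / real N" by simp
  finally show ?thesis .
qed

lemma sum_inverse_squares_le_2: "(\<Sum>n=1..M. 1 / real n ^ 2) \<le> 2"
proof (cases "M \<ge> 1")
  case True
  then have "(\<Sum>n=1..M. 1 / real n ^ 2) = 1 + (\<Sum>n=Suc 1..M. 1 / real n ^ 2)"
    by (subst sum.atLeast_Suc_atMost) auto
  then show ?thesis using sum_inverse_squares_le[of 1 M] by simp
qed simp

lemma harm_le_ln: "n \<ge> 1 \<Longrightarrow> harm n \<le> 1 + ln (real n)"
  using decseqD[OF decseq_harm_diff_ln, of 0 "n - 1"] by (simp add: harm_expand)

lemma sum_two_power_omega_pairs_le:
  assumes "p \<ge> 1"
  shows "(\<Sum>a=1..N. \<Sum>b=1..N. 2 ^ card (prime_factors a) * 2 ^ card (prime_factors b)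
            * (1 / real (max a b) ^ p))
          \<le> 2 * harm N * (\<Sum>d=1..N. 1 / real d ^ (p - 1)) ^ 2"
proof -
  let ?h = "\<lambda>n. 2 ^ card (prime_factors n) :: real" and ?t = "\<lambda>n::nat. real (card {d. d dvd n})"
  have ht: "?h n \<le> ?t n" if "n \<ge> 1" for n
    using two_power_omega_le_divisors[of n] that by (metis One_nat_def Suc_le_eq of_nat_le_iff of_nat_numeral of_nat_power)
  have "(\<Sum>a=1..N. \<Sum>b=1..N. ?h a * ?h b * (1 / real (max a b) ^ p))
      \<le> 2 * (\<Sum>n=1..N. 1 / real n ^ p * ?h n * (\<Sum>k=1..n. ?h k))"
    by (rule sum_pairs_le_max) auto
  also have "(\<Sum>n=1..N. 1 / real n ^ p * ?h n * (\<Sum>k=1..n. ?h k))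
      \<le> (\<Sum>n=1..N. harm N * (?t n / real n ^ (p - 1)))"
  proof (rule sum_mono)
    fix n assume n: "n \<in> {1..N}"
    have "(\<Sum>k=1..n. ?h k) \<le> (\<Sum>k=1..n. ?t k)" by (intro sum_mono ht) auto
    also have "\<dots> \<le> real n * harm n" by (rule sum_divisor_count_le)
    also have "\<dots> \<le> real n * harm N" using n by (intro mult_left_mono harm_mono) auto
    \<comment> \<open>the sum over the smaller entry contributes \<open>n\<close> times a harmonic number, lowering the exponent by one\<close>
    finally have "1 / real n ^ p * ?h n * (\<Sum>k=1..n. ?h k) \<le> 1 / real n ^ p * ?t n * (real n * harm N)"
      using ht[of n] n by (intro mult_mono mult_left_mono) (auto intro!: sum_nonneg mult_nonneg_nonneg)
    also have "\<dots> = harm N * (?t n / real n ^ (p - 1))"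
      using n assms by (cases p) (auto simp: field_simps)
    finally show "1 / real n ^ p * ?h n * (\<Sum>k=1..n. ?h k) \<le> harm N * (?t n / real n ^ (p - 1))" .
  qed
  also have "\<dots> = harm N * (\<Sum>n=1..N. ?t n / real n ^ (p - 1))" by (simp only: sum_distrib_left)
  also have "\<dots> \<le> harm N * (\<Sum>d=1..N. 1 / real d ^ (p - 1)) ^ 2"
    by (intro mult_left_mono sum_divisor_count_weighted_le harm_nonneg)
  finally show ?thesis by (simp add: mult_ac)
qed

section \<open>Euler products\<close>

lemma infsum_from_1_sums:
  fixes f :: "nat \<Rightarrow> real"
  assumes "f summable_on {1..}"
  shows "(\<lambda>n. f (Suc n)) sums infsum f {1..}"
    and "(\<lambda>N. \<Sum>n=1..N. f n) \<longlonglongrightarrow> infsum f {1..}"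
proof -
  have "bij_betw Suc UNIV {1..}" by (rule bij_betwI[of _ _ _ "\<lambda>n. n - 1"]) auto
  then have "((\<lambda>n. f (Suc n)) has_sum infsum f {1..}) UNIV"
    using has_sum_infsum[OF assms] has_sum_reindex_bij_betw by blast
  then show *: "(\<lambda>n. f (Suc n)) sums infsum f {1..}" by (rule has_sum_imp_sums)
  have "(\<Sum>n<N. f (Suc n)) = (\<Sum>n=1..N. f n)" for N
    by (simp add: sum.atLeast1_atMost_eq)
  then show "(\<lambda>N. \<Sum>n=1..N. f n) \<longlonglongrightarrow> infsum f {1..}" using * by (simp add: sums_def)
qed

text \<open>The Euler product restricted to a finite set \<open>P\<close> of primes: adjoining a prime \<open>q\<close>, every integer
with prime divisors in \<open>P \<union> {q}\<close> is uniquely \<open>n q\<^sup>k\<close> with the prime divisors of \<open>n\<close> in \<open>P\<close>.\<close>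

lemma infsum_smooth_eq_prod:
  fixes f :: "nat \<Rightarrow> real"
  assumes one: "f 1 = 1"
    and mult: "\<And>a b. a > 0 \<Longrightarrow> b > 0 \<Longrightarrow> coprime a b \<Longrightarrow> f (a * b) = f a * f b"
    and summ: "f summable_on {1..}"
    and "finite P" "\<And>q. q \<in> P \<Longrightarrow> prime q"
  shows "infsum f {n. 0 < n \<and> prime_factors n \<subseteq> P} = (\<Prod>q\<in>P. \<Sum>\<^sub>\<infinity>k. f (q ^ k))"
  using assms(4,5)
proof (induction P rule: finite_induct)
  case empty
  have "n = 1" if "n > 0" "prime_factors n \<subseteq> {}" for n :: nat
    using that by (simp add: prime_factorization_empty_iff)
  then have "{n. 0 < n \<and> prime_factors n \<subseteq> {}} = {1::nat}" by auto
  then show ?case using one by simp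
next
  case (insert q P)
  let ?S = "\<lambda>P. {n. 0 < n \<and> prime_factors n \<subseteq> P}"
  have q: "prime q" "q > 0" using insert.prems prime_gt_0_nat by auto
  have nd: "\<not> q dvd n" if "n \<in> ?S P" for n
    using that insert.hyps q by (auto simp: in_prime_factors_iff)
  have cop: "coprime n (q ^ k)" if "n \<in> ?S P" for n k
    using nd[OF that] q prime_imp_coprime[of q n] by (simp add: coprime_commute)
  \<comment> \<open>splitting off the power of \<open>q\<close>\<close>
  define j where "j = (\<lambda>(n, k). n * q ^ k)"
  define i where "i = (\<lambda>m. (m div q ^ multiplicity q m, multiplicity q m))"
  have 1: "i (j a) = a" if a: "a \<in> ?S P \<times> UNIV" for a
  proof -
    obtain n k where nk: "a = (n, k)" "n \<in> ?S P" using a by auto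
    have "multiplicity q (n * q ^ k) = k"
      using nd[OF nk(2)] nk q by (simp add: prime_elem_multiplicity_mult_distrib not_dvd_imp_multiplicity_0)
    then show ?thesis using q by (simp add: nk i_def j_def)
  qed
  have 2: "j a \<in> ?S (insert q P)" if a: "a \<in> ?S P \<times> UNIV" for a
  proof -
    obtain n k where nk: "a = (n, k)" "n \<in> ?S P" using a by auto
    have "prime_factors (q ^ k) \<subseteq> {q}" using q by (simp add: prime_factorization_prime_power)
    then show ?thesis using nk q by (auto simp: j_def prime_factors_product)
  qed
  have 3: "j (i b) = b" if "b \<in> ?S (insert q P)" for b
    by (simp add: i_def j_def multiplicity_dvd)
  have 4: "i b \<in> ?S P \<times> UNIV" if b: "b \<in> ?S (insert q P)" for b
  proof -
    let ?n = "b div q ^ multiplicity q b"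
    have n: "?n * q ^ multiplicity q b = b" by (simp add: multiplicity_dvd)
    then have "?n > 0" using b by (metis (mono_tags, lifting) gr0I mem_Collect_eq mult_0 less_irrefl)
    moreover have "\<not> q dvd ?n" using b q by (intro multiplicity_decompose) auto
    moreover have "?n dvd b" using n by (metis dvd_triv_left)
    then have "prime_factors ?n \<subseteq> insert q P"
      using b dvd_prime_factors[of b ?n] by auto
    ultimately show ?thesis by (auto simp: i_def in_prime_factors_iff)
  qed
  have 5: "f (j a) = (case a of (n, k) \<Rightarrow> f n * f (q ^ k))" if a: "a \<in> ?S P \<times> UNIV" for a
  proof -
    obtain n k where nk: "a = (n, k)" "n \<in> ?S P" using a by auto
    have "f (n * q ^ k) = f n * f (q ^ k)" by (rule mult) (use nk q cop[OF nk(2)] in auto)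
    then show ?thesis by (simp add: nk j_def)
  qed
  have "f summable_on ?S (insert q P)" by (rule summable_on_subset_banach[OF summ]) auto
  then have s: "(\<lambda>(n, k). f n * f (q ^ k)) summable_on ?S P \<times> UNIV"
    using summable_on_reindex_bij_witness[of "?S P \<times> UNIV" i j "?S (insert q P)" f, OF 1 2 3 4 5] by blast
  have "infsum f (?S (insert q P)) = (\<Sum>\<^sub>\<infinity>(n, k)\<in>?S P \<times> UNIV. f n * f (q ^ k))"
    using infsum_reindex_bij_witness[of "?S P \<times> UNIV" i j "?S (insert q P)" f, OF 1 2 3 4 5] by simp
  also have "\<dots> = (\<Sum>\<^sub>\<infinity>n\<in>?S P. \<Sum>\<^sub>\<infinity>k. f n * f (q ^ k))"
    using infsum_Sigma'_banach[OF s] by simp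
  also have "\<dots> = infsum f (?S P) * (\<Sum>\<^sub>\<infinity>k. f (q ^ k))"
    by (simp add: infsum_cmult_right' infsum_cmult_left')
  also have "infsum f (?S P) = (\<Prod>q\<in>P. \<Sum>\<^sub>\<infinity>k. f (q ^ k))" using insert by simp
  finally show ?case using insert by (simp add: mult.commute)
qed

text \<open>The integers having all prime divisors at most \<open>N\<close> include \<open>1,\<dots>,N\<close>, so the product over primes up
to \<open>N\<close> differs from the full sum by at most the absolute tail beyond \<open>N\<close>.\<close>

lemma euler_product:
  fixes f :: "nat \<Rightarrow> real"
  assumes one: "f 1 = 1"
    and mult: "\<And>a b. a > 0 \<Longrightarrow> b > 0 \<Longrightarrow> coprime a b \<Longrightarrow> f (a * b) = f a * f b"
    and summ: "f summable_on {1..}"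
  shows "(\<lambda>N. \<Prod>q | prime q \<and> q \<le> N. \<Sum>\<^sub>\<infinity>k. f (q ^ k)) \<longlonglongrightarrow> infsum f {1..}"
proof -
  let ?P = "\<lambda>N. {q::nat. prime q \<and> q \<le> N}" and ?S = "\<lambda>P. {n::nat. 0 < n \<and> prime_factors n \<subseteq> P}"
  have eq: "(\<Prod>q\<in>?P N. \<Sum>\<^sub>\<infinity>k. f (q ^ k)) = infsum f (?S (?P N))" for N
    by (rule infsum_smooth_eq_prod[OF one mult summ, symmetric]) auto
  have abs: "(\<lambda>n. \<bar>f n\<bar>) summable_on {1..}"
    using summ summable_on_iff_abs_summable_on_real[of f] by simp
  have bound: "norm (infsum f (?S (?P N)) - infsum f {1..}) \<le> infsum (\<lambda>n. \<bar>f n\<bar>) {1..} - (\<Sum>n=1..N. \<bar>f n\<bar>)" for N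
  proof -
    have sub: "?S (?P N) \<subseteq> {1..}" by auto
    have "infsum f {1..} - infsum f (?S (?P N)) = infsum f ({1..} - ?S (?P N))"
      using infsum_Diff[OF summ summable_on_subset_banach[OF summ sub] sub] by simp
    then have "norm (infsum f (?S (?P N)) - infsum f {1..}) = norm (infsum f ({1..} - ?S (?P N)))"
      by (simp add: abs_minus_commute)
    also have "\<dots> \<le> infsum (\<lambda>n. norm (f n)) ({1..} - ?S (?P N))"
      by (rule norm_infsum_bound) (use summable_on_subset_banach[OF abs] in auto)
    also have "\<dots> \<le> infsum (\<lambda>n. norm (f n)) ({1..} - {1..N})"
    proof (rule infsum_mono2)
      show "{1..} - ?S (?P N) \<subseteq> {1..} - {1..N}"
      proof
        fix n assume n: "n \<in> {1..} - ?S (?P N)"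
        then obtain q where q: "q \<in> prime_factors n" "\<not> q \<le> N" by (auto simp: in_prime_factors_iff)
        then have "q \<le> n" using n by (intro dvd_imp_le) auto
        then show "n \<in> {1..} - {1..N}" using n q(2) by auto
      qed
    qed (use summable_on_subset_banach[OF abs] in auto)
    also have "\<dots> = infsum (\<lambda>n. \<bar>f n\<bar>) {1..} - infsum (\<lambda>n. \<bar>f n\<bar>) {1..N}"
      using infsum_Diff[of "\<lambda>n. \<bar>f n\<bar>" "{1..}" "{1..N}"] abs by simp
    finally show ?thesis by simp
  qed
  have "(\<lambda>N. infsum (\<lambda>n. \<bar>f n\<bar>) {1..} - (\<Sum>n=1..N. \<bar>f n\<bar>)) \<longlonglongrightarrow> 0"
    using tendsto_diff[OF tendsto_const infsum_from_1_sums(2)[OF abs], of "infsum (\<lambda>n. \<bar>f n\<bar>) {1..}"]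
    by simp
  then have "(\<lambda>N. infsum f (?S (?P N)) - infsum f {1..}) \<longlonglongrightarrow> 0"
    by (rule Lim_null_comparison[rotated]) (use bound in auto)
  then show ?thesis unfolding eq by (simp add: LIM_zero_cancel)
qed

text \<open>This is \<open>\<phi>(n)/n\<close>; the product form is what the sieve produces and what the Euler product consumes.\<close>

definition coprime_density :: "nat \<Rightarrow> real" where
  "coprime_density n = (\<Prod>q\<in>prime_factors n. 1 - 1 / real q)"

lemma coprime_density_bounds: "0 \<le> coprime_density n" "coprime_density n \<le> 1"
proof -
  have "0 \<le> 1 - 1 / real q" "1 - 1 / real q \<le> 1" if "q \<in> prime_factors n" for q
    using that prime_gt_0_nat[of q] by (auto simp: in_prime_factors_imp_prime)
  then show "0 \<le> coprime_density n" "coprime_density n \<le> 1"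
    unfolding coprime_density_def by (auto intro!: prod_nonneg prod_le_1)
qed

lemma coprime_prime_factors_disjoint:
  fixes a b :: nat
  assumes "coprime a b"
  shows "prime_factors a \<inter> prime_factors b = {}"
proof -
  have False if "q \<in> prime_factors a" "q \<in> prime_factors b" for q
  proof -
    have "q dvd a" "q dvd b" "prime q" using that by auto
    then show False using coprime_common_divisor[OF assms] not_prime_unit by blast
  qed
  then show ?thesis by blast
qed

lemma coprime_density_mult:
  assumes "a > 0" "b > 0" "coprime a b"
  shows "coprime_density (a * b) = coprime_density a * coprime_density b"
  unfolding coprime_density_def using assms
  by (simp add: prime_factors_product prod.union_disjoint coprime_prime_factors_disjoint)

lemma usign_mult:
  assumes "a > 0" "b > 0" "coprime a b"
  shows "usign (a * b) = usign a * usign b"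
  unfolding usign_def using assms
  by (simp add: prime_factors_product card_Un_disjoint coprime_prime_factors_disjoint power_add)

lemma summable_on_inverse_powers:
  assumes "s \<ge> 2"
  shows "(\<lambda>n. 1 / real n ^ s) summable_on {1..}"
proof -
  have "(\<lambda>n. 1 / real n ^ s) summable_on UNIV"
    using inverse_power_summable[OF assms, where 'a = real]
    by (subst summable_on_UNIV_nonneg_real_iff) (simp_all add: divide_inverse)
  then show ?thesis by (rule summable_on_subset_banach) auto
qed

lemma infsum_geometric_from_1:
  fixes r :: real
  assumes "\<bar>r\<bar> < 1" "F 0 = 1" "\<And>k. k \<ge> 1 \<Longrightarrow> F k = c * r ^ k"
  shows "(\<Sum>\<^sub>\<infinity>k. F k) = 1 + c * (r / (1 - r))"
proof -
  have "((\<lambda>k. c * r ^ k) has_sum c * (r / (1 - r))) {1..}"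
    using assms by (intro has_sum_cmult_right has_sum_geometric_from_1) auto
  then have "(F has_sum c * (r / (1 - r))) {1..}"
    using assms(3) by (subst has_sum_cong) auto
  then have "(F has_sum F 0 + c * (r / (1 - r))) (insert 0 {1..})" by (intro has_sum_insert) auto
  moreover have "insert 0 {1..} = (UNIV :: nat set)" by auto
  ultimately show ?thesis using assms(2) infsumI by auto
qed

lemma zeta_eq_infsum:
  assumes "p \<ge> 1"
  shows "zeta (real p + 1) = (\<Sum>\<^sub>\<infinity>n\<in>{1..}. 1 / real n ^ (p + 1))"
proof -
  have eq: "1 / real (Suc n) powr (real p + 1) = 1 / real (Suc n) ^ (p + 1)" for n
    using powr_realpow[of "real (Suc n)" "p + 1"] by (simp add: add.commute)
  have "(\<lambda>n. 1 / real n ^ (p + 1)) summable_on {1..}"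
    using assms by (intro summable_on_inverse_powers) simp
  then have "(\<lambda>n. 1 / real (Suc n) ^ (p + 1)) sums (\<Sum>\<^sub>\<infinity>n\<in>{1..}. 1 / real n ^ (p + 1))"
    by (rule infsum_from_1_sums(1))
  then show ?thesis unfolding zeta_def eq by (rule sums_unique[symmetric])
qed

lemma zeta_euler_product:
  assumes "p \<ge> 1"
  shows "(\<lambda>N. \<Prod>q | prime q \<and> q \<le> N. 1 / (1 - 1 / real q ^ (p + 1))) \<longlonglongrightarrow> zeta (real p + 1)"
proof -
  have "(\<lambda>N. \<Prod>q | prime q \<and> q \<le> N. \<Sum>\<^sub>\<infinity>k. 1 / real (q ^ k) ^ (p + 1)) \<longlonglongrightarrow> zeta (real p + 1)"
    unfolding zeta_eq_infsum[OF assms]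
  proof (rule euler_product)
    show "(\<lambda>n. 1 / real n ^ (p + 1)) summable_on {1..}"
      using assms by (intro summable_on_inverse_powers) simp
  qed (simp_all add: power_mult_distrib)
  moreover have "(\<Sum>\<^sub>\<infinity>k. 1 / real (q ^ k) ^ (p + 1)) = 1 / (1 - 1 / real q ^ (p + 1))" if "prime q" for q
  proof -
    have "real q ^ (p + 1) > 1" using prime_gt_1_nat[OF that] by (intro one_less_power) auto
    then have r: "\<bar>1 / real q ^ (p + 1)\<bar> < 1" by simp
    have "(\<Sum>\<^sub>\<infinity>k. 1 / real (q ^ k) ^ (p + 1)) = 1 + 1 * ((1 / real q ^ (p + 1)) / (1 - 1 / real q ^ (p + 1)))"
    proof (rule infsum_geometric_from_1[OF r])
      fix k :: nat
      have "real (q ^ k) ^ (p + 1) = (real q ^ (p + 1)) ^ k"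
        by (simp only: of_nat_power power_mult[symmetric] mult.commute)
      then show "1 / real (q ^ k) ^ (p + 1) = 1 * (1 / real q ^ (p + 1)) ^ k"
        by (simp only: power_one_over mult_1)
    qed simp
    also have "\<dots> = 1 / (1 - 1 / real q ^ (p + 1))"
    proof -
      have "1 + 1 * (r / (1 - r)) = 1 / (1 - r)" if "\<bar>r\<bar> < 1" for r :: real
        using that by (simp add: field_simps)
      then show ?thesis using r by blast
    qed
    finally show ?thesis .
  qed
  then have "(\<Prod>q | prime q \<and> q \<le> N. \<Sum>\<^sub>\<infinity>k. 1 / real (q ^ k) ^ (p + 1))
      = (\<Prod>q | prime q \<and> q \<le> N. 1 / (1 - 1 / real q ^ (p + 1)))" for N
    by (intro prod.cong refl) (simp only: mem_Collect_eq)
  ultimately show ?thesis by (simp only:)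
qed

lemma local_factor_pos:
  assumes "p \<ge> 1" "q \<ge> 2"
  shows "local_factor p q > 0"
proof -
  have "(2::real) ^ 2 \<le> real q ^ 2" using assms by (intro power_mono) auto
  also have "\<dots> \<le> real q ^ (p + 1)" using assms by (intro power_increasing) auto
  finally have "4 \<le> real q ^ (p + 1)" by simp
  then have "2 / real q ^ (p + 1) \<le> 2 / 4" by (intro divide_left_mono) auto
  moreover have "1 / real q ^ (p + 2) \<ge> 0" by simp
  ultimately show ?thesis unfolding local_factor_def by linarith
qed

text \<open>The local factors differ from 1 by \<open>O(1/q\<^sup>2)\<close>, so the product converges absolutely and is the limit
of its partial products.\<close>

lemma D_star_limit:
  assumes "p \<ge> 1"
  shows "(\<lambda>N. \<Prod>q | prime q \<and> q \<le> N. local_factor p q) \<longlonglongrightarrow> D_star p"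
proof -
  let ?f = "\<lambda>q. if prime q then local_factor p q else 1"
  have "summable (\<lambda>q. norm (?f q - 1))"
  proof (rule summable_comparison_test')
    show "summable (\<lambda>q. 3 * inverse (real q ^ 2))" by (intro summable_mult inverse_power_summable) auto
    fix q :: nat assume q: "q \<ge> 1"
    have "1 / real q ^ k \<le> 1 / real q ^ 2" if "k \<ge> 2" for k
      using q that by (intro frac_le power_increasing) simp_all
    from this[of "p + 1"] this[of "p + 2"]
    have u: "1 / real q ^ (p + 1) \<le> 1 / real q ^ 2" "1 / real q ^ (p + 2) \<le> 1 / real q ^ 2"
      using assms by simp_all
    have l: "1 / real q ^ (p + 2) \<ge> 0" "1 / real q ^ (p + 1) \<ge> 0" "1 / real q ^ 2 \<ge> 0"
      by simp_all
    have "2 / real q ^ (p + 1) = 2 * (1 / real q ^ (p + 1))" by simp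
    then have "\<bar>local_factor p q - 1\<bar> \<le> 3 * (1 / real q ^ 2)"
      using u l unfolding local_factor_def abs_le_iff by linarith
    moreover have "3 * inverse (real q ^ 2) = 3 * (1 / real q ^ 2)" by (simp only: inverse_eq_divide)
    ultimately show "norm (norm (?f q - 1)) \<le> 3 * inverse (real q ^ 2)"
      using l(3) by (cases "prime q") (simp_all only: if_True if_False real_norm_def abs_idempotent
          diff_self abs_zero zero_le_mult_iff, simp)
  qed
  then have "convergent_prod ?f"
    by (intro abs_convergent_prod_imp_convergent_prod summable_imp_abs_convergent_prod)
  then have "(\<lambda>N. \<Prod>q\<le>N. ?f q) \<longlonglongrightarrow> D_star p" unfolding D_star_def by (rule convergent_prod_LIMSEQ)
  moreover have "(\<Prod>q\<le>N. ?f q) = (\<Prod>q | prime q \<and> q \<le> N. local_factor p q)" for N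
    by (subst prod.inter_filter[symmetric]) (auto intro!: prod.cong)
  ultimately show ?thesis by simp
qed

text \<open>The terms, at exponent \<open>p + 1\<close>, of the Dirichlet series of \<open>u(d) c(d)\<close> over the \<open>d\<close> coprime
to \<open>m\<close>; the other terms are set to 0 so that the series is multiplicative over all integers.\<close>

definition usign_term :: "nat \<Rightarrow> nat \<Rightarrow> nat \<Rightarrow> real" where
  "usign_term p m d = (if coprime d m then usign d * coprime_density d / real d ^ (p + 1) else 0)"

lemma abs_usign_term_le: "\<bar>usign_term p m d\<bar> \<le> 1 / real d ^ (p + 1)"
proof -
  have "\<bar>usign d\<bar> = 1" by (simp add: usign_def power_abs)
  then have "\<bar>usign d * coprime_density d\<bar> \<le> 1" using coprime_density_bounds[of d] by (simp add: abs_mult)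
  then show ?thesis
    by (auto simp: usign_term_def abs_mult intro!: divide_right_mono)
qed

lemma usign_term_summable:
  assumes "p \<ge> 1"
  shows "usign_term p m summable_on {1..}"
proof -
  have "(\<lambda>d. norm (usign_term p m d)) summable_on {1..}"
  proof (rule Infinite_Sum.abs_summable_on_comparison_test')
    show "(\<lambda>d. 1 / real d ^ (p + 1)) summable_on {1..}"
      using assms by (intro summable_on_inverse_powers) simp
  qed (use abs_usign_term_le in simp)
  then show ?thesis using summable_on_iff_abs_summable_on_real by blast
qed

text \<open>Both sides are limits of products over the primes up to \<open>N\<close>, and the factors agree at every prime
as soon as \<open>N \<ge> m\<close>. With \<open>r = q\<^bsup>-(p+1)\<^esup>\<close>, the factor of the series at a prime \<open>q\<close> not dividing
\<open>m\<close> is \<open>1 - (1 - 1/q) r/(1 - r)\<close>, which is the local factor of \<open>D\<close> divided by \<open>1 - r\<close>; at a prime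
dividing \<open>m\<close> it is 1, and there \<^const>\<open>g\<close> cancels the zeta and \<open>D\<close> factors, leaving the factor
\<open>1 - 1/q\<close> of \<open>c(m)\<close>.\<close>

lemma zeta_D_star_g_eq:
  assumes "p \<ge> 1" "m > 0"
  shows "zeta (real p + 1) * D_star p * g p m
       = coprime_density m * infsum (usign_term p m) {1..}"
proof -
  let ?P = "\<lambda>N. {q::nat. prime q \<and> q \<le> N}"
  let ?r = "\<lambda>q. 1 / real q ^ (p + 1)"
  let ?A = "\<lambda>q. \<Sum>\<^sub>\<infinity>k. usign_term p m (q ^ k)"
  have one: "usign_term p m 1 = 1" by (simp add: usign_term_def usign_def coprime_density_def)
  have mult: "usign_term p m (a * b) = usign_term p m a * usign_term p m b"
    if "a > 0" "b > 0" "coprime a b" for a b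
  proof -
    have "u * v * (c * d) / (x * y) = u * c / x * (v * d / y)" for u v c d x y :: real by simp
    then show ?thesis unfolding usign_term_def usign_mult[OF that] coprime_density_mult[OF that]
        of_nat_mult power_mult_distrib coprime_mult_left_iff by simp
  qed
  have lim: "(\<lambda>N. coprime_density m * (\<Prod>q\<in>?P N. ?A q)) \<longlonglongrightarrow> coprime_density m * infsum (usign_term p m) {1..}"
    by (intro tendsto_mult_left euler_product one mult usign_term_summable assms(1))
  have lim': "(\<lambda>N. (\<Prod>q\<in>?P N. 1 / (1 - ?r q)) * (\<Prod>q\<in>?P N. local_factor p q) * g p m)
      \<longlonglongrightarrow> zeta (real p + 1) * D_star p * g p m"
    by (intro tendsto_mult tendsto_const zeta_euler_product D_star_limit assms(1))
  have factor: "1 / (1 - ?r q) * local_factor p q *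
        (if q dvd m then (1 - 1 / real q) * (1 - ?r q) * inverse (local_factor p q) else 1)
      = (if q dvd m then 1 - 1 / real q else 1) * ?A q" if q: "prime q" for q
  proof -
    have "real q ^ (p + 1) > 1" using prime_gt_1_nat[OF q] by (intro one_less_power) auto
    then have r: "\<bar>?r q\<bar> < 1" by simp
    have lf: "local_factor p q > 0" using local_factor_pos assms(1) prime_ge_2_nat[OF q] by blast
    have A: "?A q = 1 + (if q dvd m then 0 else - (1 - 1 / real q)) * (?r q / (1 - ?r q))"
    proof (rule infsum_geometric_from_1[OF r])
      show "usign_term p m (q ^ 0) = 1" using one by simp
      fix k :: nat assume k: "k \<ge> 1"
      have pf: "prime_factors (q ^ k) = {q}" using q k by (simp add: prime_factorization_prime_power)
      have "coprime (q ^ k) m \<longleftrightarrow> \<not> q dvd m"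
      proof -
        have "coprime q m \<longleftrightarrow> \<not> q dvd m"
        proof
          assume "coprime q m"
          then have "is_unit q" if "q dvd m" using that by (rule coprime_common_divisor[OF _ dvd_refl])
          then show "\<not> q dvd m" using q not_prime_unit by metis
        qed (rule prime_imp_coprime[OF q])
        moreover have "k \<noteq> 0" using k by simp
        ultimately show ?thesis unfolding coprime_power_left_iff by simp
      qed
      moreover have "real (q ^ k) ^ (p + 1) = (real q ^ (p + 1)) ^ k"
        by (simp only: of_nat_power power_mult[symmetric] mult.commute)
      ultimately show "usign_term p m (q ^ k) = (if q dvd m then 0 else - (1 - 1 / real q)) * ?r q ^ k"
        by (simp add: usign_term_def usign_def coprime_density_def pf power_divide)
    qed
    show ?thesis
    proof (cases "q dvd m")
      case True
      have "1 / (1 - r) * l * ((1 - u) * (1 - r) * inverse l) = (1 - u) * (1 + 0 * (r / (1 - r)))"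
        if "\<bar>r\<bar> < 1" "l > 0" for r l u :: real using that by (simp add: field_simps)
      from this[OF r lf] show ?thesis unfolding A if_P[OF True] .
    next
      case False
      have l: "local_factor p q = 1 - 2 * ?r q + ?r q * (1 / real q)"
        unfolding local_factor_def by simp
      have "1 / (1 - r) * (1 - 2 * r + r * u) * 1 = 1 * (1 + - (1 - u) * (r / (1 - r)))"
        if "\<bar>r\<bar> < 1" for r u :: real using that by (simp add: field_simps)
      from this[OF r] show ?thesis unfolding A if_not_P[OF False] l .
    qed
  qed
  have eq: "(\<Prod>q\<in>?P N. 1 / (1 - ?r q)) * (\<Prod>q\<in>?P N. local_factor p q) * g p m
      = coprime_density m * (\<Prod>q\<in>?P N. ?A q)" if N: "N \<ge> m" for N
  proof -
    have "q \<le> N" if "q dvd m" for q using dvd_imp_le[OF that assms(2)] N by simp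
    then have sub: "{q. prime q \<and> q dvd m} = {q \<in> ?P N. q dvd m}" "prime_factors m = {q \<in> ?P N. q dvd m}"
      using assms(2) by (auto simp: in_prime_factors_iff)
    have "g p m = (\<Prod>q\<in>?P N. if q dvd m then (1 - 1 / real q) * (1 - ?r q) * inverse (local_factor p q) else 1)"
      unfolding g_def sub(1) by (rule prod.inter_filter) simp
    moreover have "coprime_density m = (\<Prod>q\<in>?P N. if q dvd m then 1 - 1 / real q else 1)"
      unfolding coprime_density_def sub(2) by (rule prod.inter_filter) simp
    ultimately show ?thesis
      by (simp only: prod.distrib[symmetric]) (rule prod.cong, use factor in auto)
  qed
  have "(\<lambda>N. (\<Prod>q\<in>?P N. 1 / (1 - ?r q)) * (\<Prod>q\<in>?P N. local_factor p q) * g p m)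
      \<longlonglongrightarrow> coprime_density m * infsum (usign_term p m) {1..}"
    by (rule Lim_transform_eventually[OF lim])
       (use eq in \<open>auto simp: eventually_at_top_linorder intro!: exI[of _ m]\<close>)
  then show ?thesis using lim' LIMSEQ_unique by blast
qed

section \<open>The constant as a sum over primitive pairs\<close>

abbreviation pairs :: "(nat \<times> nat) set" where
  "pairs \<equiv> {1..} \<times> {1..}"

text \<open>At most \<open>2 n\<close> pairs of positive integers have maximum \<open>n\<close>, so the double series is controlled by
a single one. The bound \<open>B\<close> is kept explicit because the tail estimate needs it.\<close>

lemma summable_on_pairs_max:
  fixes w :: "nat \<Rightarrow> real"
  assumes w: "\<And>n. w n \<ge> 0" and B: "\<And>M. 2 * (\<Sum>n=1..M. w n * real n) \<le> B"
  shows "(\<lambda>(a,b). w (max a b)) summable_on pairs"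
    and "(\<Sum>\<^sub>\<infinity>(a,b)\<in>pairs. w (max a b)) \<le> B"
proof -
  have fin: "(\<Sum>(a,b)\<in>F. w (max a b)) \<le> B" if F: "finite F" "F \<subseteq> pairs" for F
  proof -
    have "finite (fst ` F \<union> snd ` F)" using F by simp
    then obtain M where M: "\<And>k. k \<in> fst ` F \<union> snd ` F \<Longrightarrow> k \<le> M"
      unfolding finite_nat_set_iff_bounded_le by blast
    have "F \<subseteq> {1..M} \<times> {1..M}"
    proof
      fix ab assume ab: "ab \<in> F"
      then have "fst ab \<le> M" "snd ab \<le> M" using M by blast+
      then show "ab \<in> {1..M} \<times> {1..M}" using ab F by (auto simp: mem_Times_iff)
    qed
    then have "(\<Sum>(a,b)\<in>F. w (max a b)) \<le> (\<Sum>(a,b)\<in>{1..M} \<times> {1..M}. w (max a b))"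
      using w by (intro sum_mono2) auto
    also have "\<dots> = (\<Sum>a=1..M. \<Sum>b=1..M. 1 * 1 * w (max a b))"
      by (simp add: sum.cartesian_product)
    also have "\<dots> \<le> 2 * (\<Sum>n=1..M. w n * 1 * (\<Sum>k=1..n. 1))"
      by (rule sum_pairs_le_max) (use w in auto)
    also have "\<dots> = 2 * (\<Sum>n=1..M. w n * real n)" by simp
    finally show ?thesis using B[of M] by linarith
  qed
  show s: "(\<lambda>(a,b). w (max a b)) summable_on pairs"
    by (rule nonneg_bdd_above_summable_on) (use w fin in \<open>auto simp: bdd_above_def\<close>)
  show "(\<Sum>\<^sub>\<infinity>(a,b)\<in>pairs. w (max a b)) \<le> B"
    by (rule infsum_le_finite_sums[OF s fin])
qed

lemma inverse_power_Suc_times: "n \<ge> 1 \<Longrightarrow> 1 / real n ^ (p + 1) * real n = 1 / real n ^ p"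
  by simp

lemma summable_on_inverse_max:
  assumes "p \<ge> 2"
  shows "(\<lambda>(a,b). 1 / real (max a b) ^ (p + 1)) summable_on pairs"
proof (rule summable_on_pairs_max(1)[where B = 4])
  fix M
  have "(\<Sum>n=1..M. 1 / real n ^ (p + 1) * real n) \<le> (\<Sum>n=1..M. 1 / real n ^ 2)"
  proof (rule sum_mono)
    fix n assume n: "n \<in> {1..M}"
    then have "1 / real n ^ p \<le> 1 / real n ^ 2"
      using assms by (intro frac_le power_increasing) simp_all
    then show "1 / real n ^ (p + 1) * real n \<le> 1 / real n ^ 2" using inverse_power_Suc_times[of n p] n by simp
  qed
  then show "2 * (\<Sum>n=1..M. 1 / real n ^ (p + 1) * real n) \<le> 4"
    using sum_inverse_squares_le_2[of M] by linarith
qed simp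

lemma infsum_inverse_max_tail:
  assumes "p \<ge> 2" "N \<ge> 1"
  shows "(\<Sum>\<^sub>\<infinity>(a,b)\<in>pairs - {1..N} \<times> {1..N}. 1 / real (max a b) ^ (p + 1)) \<le> 2 / real N ^ (p - 1)"
proof -
  \<comment> \<open>a weight vanishing up to \<open>N\<close> removes exactly the square \<open>{1..N} \<times> {1..N}\<close>\<close>
  define w where "w = (\<lambda>n. if n > N then 1 / real n ^ (p + 1) else 0)"
  have "(\<Sum>\<^sub>\<infinity>(a,b)\<in>pairs - {1..N} \<times> {1..N}. 1 / real (max a b) ^ (p + 1)) = (\<Sum>\<^sub>\<infinity>(a,b)\<in>pairs. w (max a b))"
    by (rule infsum_cong_neutral) (auto simp: w_def max_def split: if_splits)
  also have "\<dots> \<le> 2 / real N ^ (p - 1)"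
  proof (rule summable_on_pairs_max(2))
    fix M
    have "(\<Sum>n=1..M. w n * real n) \<le> (\<Sum>n=Suc N..M. 1 / real N ^ (p - 2) * (1 / real n ^ 2))"
    proof -
      have "(\<Sum>n=1..M. w n * real n) = (\<Sum>n=Suc N..M. w n * real n)"
        by (rule sum.mono_neutral_right) (auto simp: w_def)
      also have "\<dots> \<le> (\<Sum>n=Suc N..M. 1 / real N ^ (p - 2) * (1 / real n ^ 2))"
      proof (rule sum_mono)
        fix n assume n: "n \<in> {Suc N..M}"
        have "real N ^ (p - 2) * real n ^ 2 \<le> real n ^ (p - 2) * real n ^ 2"
          using n by (intro mult_right_mono power_mono) auto
        also have "\<dots> = real n ^ p" using assms(1) by (simp only: power_add[symmetric] le_add_diff_inverse2)
        finally have "1 / real n ^ p \<le> 1 / (real N ^ (p - 2) * real n ^ 2)"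
          using n assms(2) by (intro frac_le) simp_all
        then show "w n * real n \<le> 1 / real N ^ (p - 2) * (1 / real n ^ 2)"
          using inverse_power_Suc_times[of n p] n by (simp add: w_def)
      qed
      finally show ?thesis .
    qed
    also have "\<dots> = 1 / real N ^ (p - 2) * (\<Sum>n=Suc N..M. 1 / real n ^ 2)"
      by (simp only: sum_distrib_left)
    also have "\<dots> \<le> 1 / real N ^ (p - 2) * (1 / real N)"
      by (intro mult_left_mono sum_inverse_squares_le assms) simp
    also have "\<dots> = 1 / real N ^ (p - 1)"
    proof -
      have "p - 1 = Suc (p - 2)" using assms(1) by simp
      then show ?thesis by simp
    qed
    finally show "2 * (\<Sum>n=1..M. w n * real n) \<le> 2 / real N ^ (p - 1)" by simp
  qed (simp add: w_def)
  finally show ?thesis .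
qed

text \<open>The terms of the series \<open>K\<close> of the introduction: pairs that are not primitive contribute 0.\<close>

definition primitive_term :: "nat \<Rightarrow> nat \<times> nat \<Rightarrow> real" where
  "primitive_term p = (\<lambda>(a,b). if gcud a b = 1 then coprime_density (a * b) / real (max a b) ^ (p + 1) else 0)"

lemma coprime_density_common_factor:
  assumes "a > 0" "b > 0" "d > 0" "coprime d (a * b)"
  shows "coprime_density (d * a * (d * b)) = coprime_density d * coprime_density (a * b)"
proof -
  have "prime_factors (d * a * (d * b)) = prime_factors (d * (a * b))"
    using assms by (auto simp: prime_factors_product)
  then have "coprime_density (d * a * (d * b)) = coprime_density (d * (a * b))"
    by (simp add: coprime_density_def)
  also have "\<dots> = coprime_density d * coprime_density (a * b)"
    by (rule coprime_density_mult) (use assms in auto)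
  finally show ?thesis .
qed

text \<open>The double counting behind the constant. A triple \<open>(a, b, d)\<close> with \<open>d\<close> coprime to \<open>a b\<close> corresponds
to the pair \<open>(A, B) = (d a, d b)\<close> together with a common unitary divisor \<open>d\<close> of it. Both \<open>c\<close> and the
maximum are compatible with this: \<open>c(d) c(a b) = c(A B)\<close>, since \<open>c\<close> depends on the set of prime divisors
only, and \<open>d max(a,b) = max(A,B)\<close>. So for given \<open>(A, B)\<close> only the sum of \<open>u(d)\<close> remains.
Absolute convergence of the triple series justifies the rearrangement.\<close>

lemma usign_series_over_pairs:
  fixes p :: nat
  assumes "p \<ge> 2"
  defines "\<phi> \<equiv> \<lambda>(a,b). coprime_density (a * b) * infsum (usign_term p (a * b)) {1..} / real (max a b) ^ (p + 1)"
  shows "\<phi> summable_on pairs" "infsum \<phi> pairs = infsum (primitive_term p) pairs"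
proof -
  let ?W = "\<lambda>ab. case ab of (a,b) \<Rightarrow> 1 / real (max a b) ^ (p + 1)"
  let ?V = "\<lambda>d::nat. 1 / real d ^ (p + 1)"
  \<comment> \<open>\<open>F1\<close> is the summand in terms of \<open>((a,b),d)\<close>, \<open>F2\<close> the same in terms of \<open>((A,B),d)\<close>\<close>
  define F1 where "F1 = (\<lambda>((a::nat,b::nat),d). coprime_density (a * b) * usign_term p (a * b) d / real (max a b) ^ (p + 1))"
  define F2 where "F2 = (\<lambda>((a::nat,b::nat),d). coprime_density (a * b) * usign d / real (max a b) ^ (p + 1))"
  define D where "D = (\<lambda>(a,b). {d. unitary_dvd d a \<and> unitary_dvd d b})"
  \<comment> \<open>\<open>X\<close> is the support of \<open>F1\<close>, and \<open>j\<close> maps it bijectively onto the index set of \<open>F2\<close>\<close>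
  define X where "X = {t \<in> pairs \<times> {1..}. coprime (snd t) (fst (fst t) * snd (fst t))}"
  define j where "j = (\<lambda>((a,b),d). ((d * a, d * b), d :: nat))"
  define i where "i = (\<lambda>((a,b),d). ((a div d, b div d), d :: nat))"
  have V: "?V summable_on {1..}" using assms(1) by (intro summable_on_inverse_powers) simp
  have "(\<lambda>t. ?W (fst t) * ?V (snd t)) summable_on pairs \<times> {1..}"
  proof (rule summable_on_SigmaI)
    fix ab
    show "((\<lambda>d. ?W (fst (ab, d)) * ?V (snd (ab, d))) has_sum ?W ab * infsum ?V {1..}) {1..}"
      using has_sum_cmult_right[OF has_sum_infsum[OF V], of "?W ab"] by simp
  next
    show "(\<lambda>ab. ?W ab * infsum ?V {1..}) summable_on pairs"
      by (rule summable_on_cmult_left[OF summable_on_inverse_max[OF assms(1)]])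
  qed (auto split: prod.split)
  then have "(\<lambda>t. norm (F1 t)) summable_on pairs \<times> {1..}"
  proof (rule Infinite_Sum.abs_summable_on_comparison_test')
    fix t :: "(nat \<times> nat) \<times> nat"
    obtain a b d where t: "t = ((a,b),d)" by (metis surj_pair)
    have "\<bar>coprime_density (a * b) * usign_term p (a * b) d\<bar> \<le> 1 * ?V d"
      unfolding abs_mult using coprime_density_bounds[of "a * b"] abs_usign_term_le[of p "a * b" d]
      by (intro mult_mono) auto
    then have "\<bar>coprime_density (a * b) * usign_term p (a * b) d\<bar> / real (max a b) ^ (p + 1)
        \<le> ?V d / real (max a b) ^ (p + 1)"
      by (intro divide_right_mono) auto
    then show "norm (F1 t) \<le> ?W (fst t) * ?V (snd t)"
      by (simp add: F1_def t abs_mult mult.commute del: power_Suc)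
  qed
  then have F1: "F1 summable_on pairs \<times> {1..}"
    using summable_on_iff_abs_summable_on_real by blast
  then have F1': "(\<lambda>(ab, d). F1 (ab, d)) summable_on pairs \<times> {1..}" by (simp add: case_prod_eta)
  have phi: "\<phi> ab = (\<Sum>\<^sub>\<infinity>d\<in>{1..}. F1 (ab, d))" for ab
  proof -
    obtain a b where ab: "ab = (a,b)" by (cases ab)
    have "(\<Sum>\<^sub>\<infinity>d\<in>{1..}. F1 (ab, d))
        = (\<Sum>\<^sub>\<infinity>d\<in>{1..}. coprime_density (a * b) / real (max a b) ^ (p + 1) * usign_term p (a * b) d)"
      by (simp add: F1_def ab)
    also have "\<dots> = coprime_density (a * b) / real (max a b) ^ (p + 1) * infsum (usign_term p (a * b)) {1..}"
      by (rule infsum_cmult_right')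
    finally show ?thesis by (simp add: \<phi>_def ab)
  qed
  have phi': "\<phi> = (\<lambda>ab. \<Sum>\<^sub>\<infinity>d\<in>{1..}. F1 (ab, d))" using phi by blast
  show "\<phi> summable_on pairs" unfolding phi' by (rule summable_on_Sigma_banach[OF F1'])
  have "infsum \<phi> pairs = infsum F1 (pairs \<times> {1..})"
    unfolding phi' by (rule infsum_Sigma_banach[OF F1])
  also have "\<dots> = infsum F1 X"
    by (rule infsum_cong_neutral) (auto simp: X_def F1_def usign_term_def)
  also have F2_sum: "\<dots> = infsum F2 (Sigma pairs D)" and F2: "F2 summable_on Sigma pairs D"
  proof -
    have 1: "i (j t) = t" if "t \<in> X" for t
      using that by (auto simp: X_def i_def j_def)
    have 2: "j t \<in> Sigma pairs D" if "t \<in> X" for t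
    proof -
      obtain a b d where t: "t = ((a,b),d)" by (metis surj_pair)
      have "a \<ge> 1" "b \<ge> 1" "d \<ge> 1" "coprime d a" "coprime d b"
        using that by (simp_all add: X_def t coprime_mult_right_iff)
      then show ?thesis by (simp add: t j_def D_def unitary_dvd_def)
    qed
    have dec: "\<exists>a b. t = ((d * a, d * b), d) \<and> a \<ge> 1 \<and> b \<ge> 1 \<and> d \<ge> 1 \<and> coprime d a \<and> coprime d b"
      if t_in: "t \<in> Sigma pairs D" and d_eq: "d = snd t" for t d
    proof -
      obtain A B where t: "t = ((A,B),d)" using d_eq by (metis surj_pair prod.collapse)
      have u: "unitary_dvd d A" "unitary_dvd d B" using t_in by (simp_all add: t D_def)
      have d: "d \<ge> 1" using unitary_dvd_pos[OF u(1)] by simp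
      have "A = d * (A div d)" "B = d * (B div d)" "A > 0" "B > 0" using u by (auto simp: unitary_dvd_def)
      moreover from this have "A div d \<ge> 1" "B div d \<ge> 1" by (metis One_nat_def Suc_leI gr0I mult_0_right)+
      moreover have "coprime d (A div d)" "coprime d (B div d)" using u by (auto simp: unitary_dvd_def)
      ultimately show ?thesis using t d by metis
    qed
    have 3: "j (i t) = t" and 4: "i t \<in> X" if t_in: "t \<in> Sigma pairs D" for t
    proof -
      obtain a b d where t: "t = ((d * a, d * b), d)" "a \<ge> 1" "b \<ge> 1" "d \<ge> 1" "coprime d a" "coprime d b"
        using dec[OF t_in refl] by blast
      then have "i t = ((a,b),d)" by (simp add: i_def)
      then show "j (i t) = t" "i t \<in> X" using t by (simp_all add: j_def X_def coprime_mult_right_iff)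
    qed
    have 5: "F2 (j t) = F1 t" if "t \<in> X" for t
    proof -
      obtain a b d where t: "t = ((a,b),d)" by (metis surj_pair)
      have *: "a > 0" "b > 0" "d > 0" "coprime d (a * b)" using that by (simp_all add: X_def t)
      have "real (max (d * a) (d * b)) ^ (p + 1) = real d ^ (p + 1) * real (max a b) ^ (p + 1)"
        by (simp only: nat_mult_max_right[symmetric] of_nat_mult power_mult_distrib)
      then have "F2 (j t) = coprime_density d * coprime_density (a * b) * usign d / (real d ^ (p + 1) * real (max a b) ^ (p + 1))"
        using coprime_density_common_factor[OF *] by (simp add: F2_def j_def t)
      also have "\<dots> = F1 t" using * by (simp add: F1_def t usign_term_def)
      finally show ?thesis .
    qed
    show "infsum F1 X = infsum F2 (Sigma pairs D)"
      using infsum_reindex_bij_witness[of X i j "Sigma pairs D" F2 F1, OF 1 2 3 4 5] .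
    have "F1 summable_on X" by (rule summable_on_subset_banach[OF F1]) (auto simp: X_def)
    then show "F2 summable_on Sigma pairs D"
      using summable_on_reindex_bij_witness[of X i j "Sigma pairs D" F2 F1, OF 1 2 3 4 5] by blast
  qed
  note F2_sum
  also have "infsum F2 (Sigma pairs D) = (\<Sum>\<^sub>\<infinity>ab\<in>pairs. \<Sum>\<^sub>\<infinity>d\<in>D ab. F2 (ab, d))"
    by (rule infsum_Sigma_banach[OF F2, symmetric])
  also have "\<dots> = infsum (primitive_term p) pairs"
  proof (rule infsum_cong)
    fix ab assume "ab \<in> pairs"
    then obtain a b where ab: "ab = (a,b)" "a > 0" "b > 0" by auto
    have D: "D ab = {d. unitary_dvd d a \<and> unitary_dvd d b}" by (simp add: D_def ab)
    have fin: "finite (D ab)" unfolding D by (rule finite_common_unitary[OF ab(2,3)])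
    then have "(\<Sum>\<^sub>\<infinity>d\<in>D ab. F2 (ab, d)) = (\<Sum>d\<in>D ab. F2 (ab, d))" by simp
    also have "\<dots> = coprime_density (a * b) / real (max a b) ^ (p + 1) * (\<Sum>d\<in>D ab. usign d)"
      unfolding sum_distrib_left by (rule sum.cong) (simp_all add: F2_def ab)
    also have "\<dots> = primitive_term p ab"
      unfolding D sum_usign_common_unitary[OF ab(2,3)] by (simp add: primitive_term_def ab)
    finally show "(\<Sum>\<^sub>\<infinity>d\<in>D ab. F2 (ab, d)) = primitive_term p ab" .
  qed
  finally show "infsum \<phi> pairs = infsum (primitive_term p) pairs" .
qed

text \<open>The pairs with maximum \<open>n\<close> form a row and a column of length \<open>n\<close> meeting in \<open>(n, n)\<close>.\<close>

lemma sum_g_over_max: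
  assumes "n \<ge> 1"
  shows "(\<Sum>(a,b) | a \<ge> 1 \<and> b \<ge> 1 \<and> max a b = n. g p (a * b)) = 2 * G_bar p n - g p (n\<^sup>2)"
proof -
  let ?A = "(\<lambda>k. (k, n)) ` {1..n}" and ?B = "(\<lambda>k. (n, k)) ` {1..n}"
  let ?f = "\<lambda>(a,b). g p (a * b)"
  have U: "{(a,b). a \<ge> 1 \<and> b \<ge> 1 \<and> max a b = n} = ?A \<union> ?B" using assms by (auto simp: max_def)
  have I: "?A \<inter> ?B = {(n,n)}" using assms by auto
  have "sum ?f (?A \<union> ?B) + sum ?f (?A \<inter> ?B) = sum ?f ?A + sum ?f ?B"
    by (rule sum.union_inter) auto
  moreover have "sum ?f ?A = G_bar p n" "sum ?f ?B = G_bar p n"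
    unfolding G_bar_def by (subst sum.reindex; auto simp: inj_on_def mult.commute)+
  moreover have "sum ?f (?A \<inter> ?B) = g p (n\<^sup>2)" unfolding I by (simp add: power2_eq_square)
  ultimately show ?thesis unfolding U by linarith
qed

lemma infsum_pairs_by_max:
  fixes f :: "nat \<times> nat \<Rightarrow> real"
  assumes "f summable_on pairs"
  shows "(\<lambda>n. \<Sum>ab | fst ab \<ge> 1 \<and> snd ab \<ge> 1 \<and> max (fst ab) (snd ab) = n. f ab) summable_on {1..}"
    and "(\<Sum>\<^sub>\<infinity>n\<in>{1..}. \<Sum>ab | fst ab \<ge> 1 \<and> snd ab \<ge> 1 \<and> max (fst ab) (snd ab) = n. f ab) = infsum f pairs"
proof -
  let ?M = "\<lambda>n::nat. {ab :: nat \<times> nat. fst ab \<ge> 1 \<and> snd ab \<ge> 1 \<and> max (fst ab) (snd ab) = n}"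
  have fin: "finite (?M n)" for n
    by (rule finite_subset[of _ "{..n} \<times> {..n}"]) auto
  note W = summable_on_reindex_bij_witness[of "Sigma {1..} ?M" "\<lambda>ab. (max (fst ab) (snd ab), ab)" snd pairs f "\<lambda>(n, ab). f ab"]
     infsum_reindex_bij_witness[of "Sigma {1..} ?M" "\<lambda>ab. (max (fst ab) (snd ab), ab)" snd pairs f "\<lambda>(n, ab). f ab"]
  have s: "(\<lambda>(n, ab). f ab) summable_on Sigma {1..} ?M"
    using assms by (subst W(1)) auto
  have eq: "(\<Sum>\<^sub>\<infinity>ab\<in>?M n. f ab) = (\<Sum>ab\<in>?M n. f ab)" for n
    using fin by (rule infsum_finite)
  show "(\<lambda>n. \<Sum>ab\<in>?M n. f ab) summable_on {1..}"
    using summable_on_Sigma_banach[OF s] unfolding eq .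
  have "(\<Sum>\<^sub>\<infinity>n\<in>{1..}. \<Sum>ab\<in>?M n. f ab) = infsum (\<lambda>(n, ab). f ab) (Sigma {1..} ?M)"
    using infsum_Sigma'_banach[OF s] unfolding eq .
  also have "\<dots> = infsum f pairs" by (rule W(2)) auto
  finally show "(\<Sum>\<^sub>\<infinity>n\<in>{1..}. \<Sum>ab\<in>?M n. f ab) = infsum f pairs" .
qed

text \<open>The double series of \<open>\<zeta>(p+1) D g(a b) / M\<^bsup>p+1\<^esup>\<close>, grouped by \<open>M\<close>, is the series defining the
constant; by the double counting above it equals \<open>K\<close>.\<close>

lemma C_star_star_eq:
  assumes "p \<ge> 2"
  shows "C_star_star p = infsum (primitive_term p) pairs / (real p + 1)"
proof -
  define Z where "Z = zeta (real p + 1) * D_star p"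
  let ?\<phi> = "\<lambda>(a,b). coprime_density (a * b) * infsum (usign_term p (a * b)) {1..} / real (max a b) ^ (p + 1)"
  let ?h = "\<lambda>n. (2 * G_bar p n - g p (n\<^sup>2)) / real n ^ (p + 1)"
  let ?M = "\<lambda>n::nat. {ab :: nat \<times> nat. fst ab \<ge> 1 \<and> snd ab \<ge> 1 \<and> max (fst ab) (snd ab) = n}"
  have M: "(\<Sum>ab\<in>?M n. ?\<phi> ab) = Z * ?h n" if n: "n \<in> {1..}" for n
  proof -
    have "(\<Sum>ab\<in>?M n. ?\<phi> ab) = (\<Sum>ab\<in>?M n. Z / real n ^ (p + 1) * (case ab of (a,b) \<Rightarrow> g p (a * b)))"
    proof (rule sum.cong)
      fix ab assume "ab \<in> ?M n"
      then obtain a b where ab: "ab = (a,b)" "a \<ge> 1" "b \<ge> 1" "max a b = n" by (cases ab) auto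
      have "Z * g p (a * b) = coprime_density (a * b) * infsum (usign_term p (a * b)) {1..}"
        unfolding Z_def by (rule zeta_D_star_g_eq) (use assms ab in auto)
      then show "?\<phi> ab = Z / real n ^ (p + 1) * (case ab of (a,b) \<Rightarrow> g p (a * b))"
        using ab by simp
    qed simp
    also have "\<dots> = Z / real n ^ (p + 1) * (\<Sum>(a,b)\<in>?M n. g p (a * b))"
      by (simp only: sum_distrib_left)
    also have "(\<Sum>(a,b)\<in>?M n. g p (a * b)) = 2 * G_bar p n - g p (n\<^sup>2)"
    proof -
      have "?M n = {(a,b). a \<ge> 1 \<and> b \<ge> 1 \<and> max a b = n}" by auto
      moreover have "n \<ge> 1" using n by simp
      ultimately show ?thesis using sum_g_over_max[of n p] by (simp only:)
    qed
    finally show ?thesis by simp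
  qed
  note \<phi> = usign_series_over_pairs[OF assms]
  note by_max = infsum_pairs_by_max[OF \<phi>(1)]
  have "(\<lambda>n. Z * ?h n) summable_on {1..}"
    by (rule iffD1[OF summable_on_cong by_max(1)]) (rule M)
  then have "(\<lambda>n. Z * ?h (Suc n)) sums infsum (\<lambda>n. Z * ?h n) {1..}" by (rule infsum_from_1_sums(1))
  also have "infsum (\<lambda>n. Z * ?h n) {1..} = infsum (primitive_term p) pairs"
  proof -
    have "infsum (\<lambda>n. Z * ?h n) {1..} = (\<Sum>\<^sub>\<infinity>n\<in>{1..}. \<Sum>ab\<in>?M n. ?\<phi> ab)"
      by (rule infsum_cong) (rule M[symmetric])
    then show ?thesis using by_max(2) \<phi>(2) by (simp only:)
  qed
  finally have sums: "(\<lambda>n. Z * ?h (Suc n)) sums infsum (primitive_term p) pairs" .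
  have "Z * (\<Sum>n. ?h (Suc n)) = infsum (primitive_term p) pairs"
  \<comment> \<open>a nonzero \<open>Z\<close> can be divided out of the series; for \<open>Z = 0\<close> both sides vanish\<close>
  proof (cases "Z = 0")
    case True
    then have "infsum (primitive_term p) pairs = 0"
      using sums by (intro sums_unique2[OF sums]) simp
    then show ?thesis using True by simp
  next
    case False
    have "(\<lambda>n. ?h (Suc n)) sums (infsum (primitive_term p) pairs / Z)"
      by (rule sums_mult_D[OF sums False])
    then have "(\<Sum>n. ?h (Suc n)) = infsum (primitive_term p) pairs / Z"
      by (rule sums_unique[symmetric])
    then show ?thesis using False by simp
  qed
  moreover have "C_star_star p = Z * (\<Sum>n. ?h (Suc n)) / (real p + 1)"
    unfolding C_star_star_def Z_def by simp
  ultimately show ?thesis by simp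
qed

section \<open>The asymptotic formula\<close>

lemma reals_upto_eq_atLeastAtMost:
  assumes "0 \<le> x"
  shows "{i. 0 < i \<and> real i \<le> x} = {1..nat \<lfloor>x\<rfloor>}"
  using assms by (auto simp: le_nat_iff le_floor_iff)

lemma abs_primitive_term_le:
  "\<bar>primitive_term p ab\<bar> \<le> (case ab of (a,b) \<Rightarrow> 1 / real (max a b) ^ (p + 1))"
proof -
  obtain a b where ab: "ab = (a,b)" by (cases ab)
  have "\<bar>coprime_density (a * b)\<bar> \<le> 1" using coprime_density_bounds[of "a * b"] by simp
  then have "\<bar>coprime_density (a * b)\<bar> / real (max a b) ^ (p + 1) \<le> 1 / real (max a b) ^ (p + 1)"
    by (intro divide_right_mono) simp_all
  then show ?thesis by (simp add: primitive_term_def ab del: power_Suc)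
qed

lemma primitive_term_tail:
  assumes "p \<ge> 2" "N \<ge> 1"
  shows "\<bar>infsum (primitive_term p) pairs - (\<Sum>ab\<in>{1..N} \<times> {1..N}. primitive_term p ab)\<bar> \<le> 2 / real N ^ (p - 1)"
proof -
  let ?W = "\<lambda>(a,b). 1 / real (max a b) ^ (p + 1)" and ?B = "{1..N} \<times> {1..N}"
  note W = summable_on_inverse_max[OF assms(1)]
  have abs: "(\<lambda>ab. norm (primitive_term p ab)) summable_on pairs"
    by (rule Infinite_Sum.abs_summable_on_comparison_test'[OF W]) (simp only: real_norm_def abs_primitive_term_le)
  then have s: "primitive_term p summable_on pairs" using summable_on_iff_abs_summable_on_real by blast
  have sub: "?B \<subseteq> pairs" by auto
  have "infsum (primitive_term p) (pairs - ?B)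
      = infsum (primitive_term p) pairs - infsum (primitive_term p) ?B"
    by (rule infsum_Diff[OF s _ sub]) simp
  then have "\<bar>infsum (primitive_term p) pairs - (\<Sum>ab\<in>?B. primitive_term p ab)\<bar>
      = norm (infsum (primitive_term p) (pairs - ?B))"
    by simp
  also have "\<dots> \<le> (\<Sum>\<^sub>\<infinity>ab\<in>pairs - ?B. norm (primitive_term p ab))"
    by (rule norm_infsum_bound) (rule summable_on_subset_banach[OF abs], blast)
  also have "\<dots> \<le> infsum ?W (pairs - ?B)"
  proof (rule infsum_mono)
    show "(\<lambda>ab. norm (primitive_term p ab)) summable_on pairs - ?B"
      by (rule summable_on_subset_banach[OF abs]) blast
    show "?W summable_on pairs - ?B"
      by (rule summable_on_subset_banach[OF W]) blast
  qed (simp only: real_norm_def abs_primitive_term_le)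
  also have "\<dots> \<le> 2 / real N ^ (p - 1)" by (rule infsum_inverse_max_tail[OF assms])
  finally show ?thesis .
qed

lemma coprime_power_sum_pair_estimate:
  assumes "a \<ge> 1" "b \<ge> 1" "0 \<le> x" "gcud a b = 1"
  shows "\<bar>coprime_power_sum p (prime_factors (a * b)) (x / real (max a b))
            - x ^ (p + 1) / real (p + 1) * primitive_term p (a, b)\<bar>
         \<le> x ^ p * (2 ^ card (prime_factors a) * 2 ^ card (prime_factors b) * (1 / real (max a b) ^ p))"
proof -
  let ?T = "coprime_power_sum p (prime_factors (a * b)) (x / real (max a b))"
  have "\<bar>?T - (\<Prod>q\<in>prime_factors (a * b). 1 - 1 / real q) * (x / real (max a b)) ^ (p + 1) / real (p + 1)\<bar>
      \<le> 2 ^ card (prime_factors (a * b)) * (x / real (max a b)) ^ p"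
    by (rule coprime_power_sum_estimate) (use assms in auto)
  moreover have "(\<Prod>q\<in>prime_factors (a * b). 1 - 1 / real q) * (x / real (max a b)) ^ (p + 1) / real (p + 1)
      = x ^ (p + 1) / real (p + 1) * primitive_term p (a, b)"
    using assms by (simp add: primitive_term_def coprime_density_def power_divide mult.commute del: power_Suc)
  moreover have "2 ^ card (prime_factors (a * b)) * (x / real (max a b)) ^ p
      \<le> x ^ p * (2 ^ card (prime_factors a) * 2 ^ card (prime_factors b) * (1 / real (max a b) ^ p))"
  proof -
    have "card (prime_factors (a * b)) \<le> card (prime_factors a) + card (prime_factors b)"
      using assms card_Un_le by (simp add: prime_factors_product)
    then have "(2::real) ^ card (prime_factors (a * b)) \<le> 2 ^ card (prime_factors a) * 2 ^ card (prime_factors b)"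
      unfolding power_add[symmetric] by (intro power_increasing) auto
    then have "2 ^ card (prime_factors (a * b)) * (x / real (max a b)) ^ p
        \<le> 2 ^ card (prime_factors a) * 2 ^ card (prime_factors b) * (x / real (max a b)) ^ p"
      using assms by (intro mult_right_mono) auto
    then show ?thesis by (simp add: power_divide mult_ac)
  qed
  ultimately show ?thesis by linarith
qed

text \<open>The first error summand collects the errors of the inner power sums, the second is the tail of the
series for the constant, where \<open>x < N + 1 \<le> 2 N\<close> turns \<open>x\<^bsup>p+1\<^esup>/N\<^bsup>p-1\<^esup>\<close> into a multiple of
\<open>x\<^sup>2 \<le> x\<^sup>p\<close>.\<close>

lemma gcud_power_sum_bound:
  fixes x :: real
  assumes p: "p \<ge> 2" and x: "x \<ge> 1"
  defines "N \<equiv> nat \<lfloor>x\<rfloor>"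
  shows "\<bar>(\<Sum>i | 0 < i \<and> real i \<le> x. \<Sum>j | 0 < j \<and> real j \<le> x. real (gcud i j) ^ p)
            - C_star_star p * x ^ (p + 1)\<bar>
         \<le> x ^ p * (2 * harm N * (\<Sum>d=1..N. 1 / real d ^ (p - 1)) ^ 2 + 2 ^ p)"
proof -
  let ?I = "{i. 0 < i \<and> real i \<le> x}" and ?f = "primitive_term p"
  let ?S = "\<Sum>i\<in>?I. \<Sum>j\<in>?I. real (gcud i j) ^ p"
  let ?A = "{(a,b). a \<in> ?I \<and> b \<in> ?I \<and> gcud a b = 1}"
  let ?T = "\<lambda>(a,b). coprime_power_sum p (prime_factors (a * b)) (x / real (max a b))"
  let ?e = "\<lambda>a b. 2 ^ card (prime_factors a) * 2 ^ card (prime_factors b) * (1 / real (max a b) ^ p)"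
  let ?y = "x ^ (p + 1) / real (p + 1)"
  have I: "?I = {1..N}" unfolding N_def using x by (intro reals_upto_eq_atLeastAtMost) simp
  have N: "N \<ge> 1" "x < real N + 1" "real N \<le> x" using x unfolding N_def by linarith+
  have A: "?A \<subseteq> {1..N} \<times> {1..N}" unfolding I by auto
  have S: "?S = sum ?T ?A" by (rule sum_gcud_power_eq)
  have f: "sum ?f ({1..N} \<times> {1..N}) = sum ?f ?A"
    by (rule sum.mono_neutral_right) (unfold I, auto simp: primitive_term_def split: if_splits)
  have "\<bar>sum ?T ?A - ?y * sum ?f ?A\<bar> = \<bar>\<Sum>ab\<in>?A. ?T ab - ?y * ?f ab\<bar>"
    by (simp only: sum_subtractf sum_distrib_left)
  also have "\<dots> \<le> (\<Sum>ab\<in>?A. \<bar>?T ab - ?y * ?f ab\<bar>)" by (rule sum_abs)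
  also have "\<dots> \<le> (\<Sum>ab\<in>?A. case ab of (a,b) \<Rightarrow> x ^ p * ?e a b)"
  proof (rule sum_mono)
    fix ab assume "ab \<in> ?A"
    then obtain a b where ab: "ab = (a,b)" "a \<ge> 1" "b \<ge> 1" "gcud a b = 1" by auto
    show "\<bar>?T ab - ?y * ?f ab\<bar> \<le> (case ab of (a,b) \<Rightarrow> x ^ p * ?e a b)"
      unfolding ab(1) prod.case by (rule coprime_power_sum_pair_estimate) (use ab x in auto)
  qed
  also have "\<dots> \<le> (\<Sum>ab\<in>{1..N} \<times> {1..N}. case ab of (a,b) \<Rightarrow> x ^ p * ?e a b)"
    using A x by (intro sum_mono2) auto
  also have "\<dots> = x ^ p * (\<Sum>a=1..N. \<Sum>b=1..N. ?e a b)"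
    unfolding sum_distrib_left by (rule sum.cartesian_product[symmetric])
  also have "\<dots> \<le> x ^ p * (2 * harm N * (\<Sum>d=1..N. 1 / real d ^ (p - 1)) ^ 2)"
    using p x by (intro mult_left_mono sum_two_power_omega_pairs_le) auto
  finally have 1: "\<bar>?S - ?y * sum ?f ?A\<bar> \<le> x ^ p * (2 * harm N * (\<Sum>d=1..N. 1 / real d ^ (p - 1)) ^ 2)"
    unfolding S .
  have C: "C_star_star p * x ^ (p + 1) = ?y * infsum ?f pairs"
    unfolding C_star_star_eq[OF p] by (simp add: mult.commute add.commute)
  have "\<bar>?y * infsum ?f pairs - ?y * sum ?f ?A\<bar> = ?y * \<bar>infsum ?f pairs - sum ?f ?A\<bar>"
    unfolding right_diff_distrib[symmetric] abs_mult using x by simp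
  also have "\<dots> \<le> x ^ (p + 1) * (2 / real N ^ (p - 1))"
  proof (intro mult_mono)
    show "?y \<le> x ^ (p + 1)" using x by (simp add: divide_le_eq mult_left_le_one_le)
    show "\<bar>infsum ?f pairs - sum ?f ?A\<bar> \<le> 2 / real N ^ (p - 1)"
      using primitive_term_tail[OF p N(1)] unfolding f .
  qed (use x in auto)
  also have "\<dots> \<le> x ^ p * 2 ^ p"
  proof -
    obtain r where r: "p = Suc r" "r \<ge> 1" using p by (cases p) auto
    have "x / real N \<le> 2" using N by (simp add: divide_le_eq)
    then have "(x / real N) ^ r \<le> 2 ^ r" using x by (intro power_mono) auto
    have "x ^ (p + 1) * (2 / real N ^ (p - 1)) = x ^ 2 * 2 * (x / real N) ^ r"
      by (simp add: r power_divide power2_eq_square)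
    also have "\<dots> \<le> x ^ 2 * 2 * 2 ^ r"
      using \<open>(x / real N) ^ r \<le> 2 ^ r\<close> x by (intro mult_left_mono) auto
    also have "\<dots> \<le> x ^ p * 2 * 2 ^ r"
      using x p by (intro mult_right_mono power_increasing) auto
    finally show ?thesis by (simp add: r mult_ac)
  qed
  finally have 2: "\<bar>?y * infsum ?f pairs - ?y * sum ?f ?A\<bar> \<le> x ^ p * 2 ^ p" .
  show ?thesis unfolding C using 1 2 unfolding distrib_left by linarith
qed

theorem theorem6p5:
  fixes p :: nat
  assumes "p \<ge> 2"
  shows "(\<lambda>x::real.
            (\<Sum>i | 0 < i \<and> real i \<le> x. \<Sum>j | 0 < j \<and> real j \<le> x. real (gcud i j) ^ p)
              - C_star_star p * x ^ (p + 1))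
         \<in> O[at_top](\<lambda>x. E_star_star p x)"
proof (rule bigoI)
  show "\<forall>\<^sub>F x::real in at_top.
      norm ((\<Sum>i | 0 < i \<and> real i \<le> x. \<Sum>j | 0 < j \<and> real j \<le> x. real (gcud i j) ^ p)
              - C_star_star p * x ^ (p + 1))
      \<le> (16 + 2 ^ p) * norm (E_star_star p x)"
    \<comment> \<open>from \<open>x \<ge> 3 \<ge> e\<close> on, \<open>ln x \<ge> 1\<close>; then harmonic numbers up to \<open>x\<close> are at most \<open>2 ln x\<close>, and both cases below arrive at the factor \<open>16 = 2 * 2\<^sup>3\<close>\<close>
    using eventually_ge_at_top[of 3]
  proof eventually_elim
    case (elim x)
    define N where "N = nat \<lfloor>x\<rfloor>"
    have N: "N \<ge> 1" "real N \<le> x" using elim unfolding N_def by linarith+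
    have "exp 1 \<le> x" using exp_le elim by linarith
    then have ln: "ln x \<ge> 1" using elim by (simp add: ln_ge_iff)
    have "ln (real N) \<le> ln x" using N by (simp add: ln_mono)
    then have harm: "harm N \<le> 2 * ln x" using harm_le_ln[OF N(1)] ln by linarith
    have harm0: "harm N \<ge> (0::real)" by (rule harm_nonneg)
    let ?B = "2 * harm N * (\<Sum>d=1..N. 1 / real d ^ (p - 1)) ^ 2 + 2 ^ p"
    let ?L = "if p = 2 then ln x ^ 3 else ln x"
    have L: "?L \<ge> 1" using ln by (simp add: one_le_power)
    have E: "E_star_star p x = x ^ p * ?L" by (simp add: E_star_star_def)
    have "?B \<le> 16 * ?L + 2 ^ p"
    proof (cases "p = 2")
      case True
      have "(\<Sum>d=1..N. 1 / real d ^ (p - 1)) = harm N"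
        by (simp add: True harm_def inverse_eq_divide)
      then have "2 * harm N * (\<Sum>d=1..N. 1 / real d ^ (p - 1)) ^ 2 = 2 * harm N ^ 3"
        by (simp add: power2_eq_square power3_eq_cube)
      also have "\<dots> \<le> 2 * (2 * ln x) ^ 3"
        using harm harm0 by (intro mult_left_mono power_mono) auto
      also have "\<dots> = 16 * ?L" using True by (simp add: power_mult_distrib)
      finally show ?thesis by simp
    next
      case False
      have "(\<Sum>d=1..N. 1 / real d ^ (p - 1)) \<le> (\<Sum>d=1..N. 1 / real d ^ 2)"
        using False assms by (intro sum_mono frac_le power_increasing) auto
      also have "\<dots> \<le> 2" by (rule sum_inverse_squares_le_2)
      finally have "(\<Sum>d=1..N. 1 / real d ^ (p - 1)) ^ 2 \<le> 2 ^ 2"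
        by (intro power_mono sum_nonneg) auto
      then have "2 * harm N * (\<Sum>d=1..N. 1 / real d ^ (p - 1)) ^ 2 \<le> 2 * (2 * ln x) * 2 ^ 2"
        using harm harm0 ln by (intro mult_mono) auto
      then show ?thesis using False by simp
    qed
    also have "\<dots> \<le> (16 + 2 ^ p) * ?L"
      using mult_left_mono[OF L, of "2 ^ p"] by (simp only: distrib_right) simp
    finally have "x ^ p * ?B \<le> x ^ p * ((16 + 2 ^ p) * ?L)"
      using elim by (intro mult_left_mono) auto
    also have "\<dots> = (16 + 2 ^ p) * E_star_star p x" unfolding E by (simp only: mult_ac)
    also have "\<dots> \<le> (16 + 2 ^ p) * norm (E_star_star p x)"
      by (intro mult_left_mono) auto
    finally show ?case
      using gcud_power_sum_bound[OF assms, of x] elim unfolding N_def[symmetric] by simp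
  qed
qed

end
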